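(* Let $\mu>0$ and $a>0$ be constants and let $n\geq2$ be an integer. Define $\bar{\mathbf{u}}:(0,\infty)\times\mathbb{R}^n\to\mathbb{R}^n$ by $$\bar{\mathbf{u}}(t,\mathbf{x})=\bar u(t,|\mathbf{x}|)\frac{\mathbf{x}}{|\mathbf{x}|}\ \ (t>0,\ \mathbf{x}\neq\mathbf{0}),\qquad \bar{\mathbf{u}}(t,\mathbf{0})=\mathbf{0}\ \ (t>0),$$ where $$\bar u(t,r)=\frac{r}{t\left[1+a(4\pi\mu t)^{n/2}\exp\left(\frac{r^2}{4\mu t}\right)\right]}.$$ Then $\bar{\mathbf{u}}$ is a non-trivial classical solution of $\mathbf{u}_t+(\mathbf{u}\cdot\nabla)\mathbf{u}=\mu\Delta\mathbf{u}$ on all of $(0,\infty)\times\mathbb{R}^n$, $\|\bar{\mathbf{u}}(t)\|_{L^\infty(\mathbb{R}^n)}\to\infty$ as $t\to0+$, and: (1) if $1\leq p<\frac n2$, then $\|\bar{\mathbf{u}}(t)\|_{W^{1,p}(\mathbb{R}^n)}\to0$ as $t\to0+$; (2) if $1\leq p<\frac n3$, then $\|\bar{\mathbf{u}}(t)\|_{W^{2,p}(\mathbb{R}^n)}\to0$ as $t\to0+$. In particular, the Cauchy problem for this system with vanishing initial data (attained in the $W^{1,p}(\mathbb{R}^n)$, respectively $W^{2,p}(\mathbb{R}^n)$, sense) has, besides the trivial solution $\mathbf{u}\equiv\mathbf{0}$, the non-trivial solution $\bar{\mathbf{u}}$ when $1\leq p<\frac n2$, respectively $1\leq p<\frac n3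$.
   Context: For $\mathbf{u}=(u_1,\dots,u_n)^T$ depending on $(t,\mathbf{x})$ with $t>0$, $\mathbf{x}\in\mathbb{R}^n$, one sets $(\mathbf{u}\cdot\nabla)\mathbf{u}:=(D_{\mathbf{x}}\mathbf{u})\,\mathbf{u}$, where $D_{\mathbf{x}}\mathbf{u}$ is the Jacobian matrix of $\mathbf{u}$ with respect to $\mathbf{x}$; $\Delta$ is the Laplacian in $\mathbf{x}$, acting component-wise. A classical solution on $(0,\infty)\times\mathbb{R}^n$ is a function for which $\mathbf{u}_t$, $D_{\mathbf{x}}\mathbf{u}$, $\Delta\mathbf{u}$ exist and are continuous on $(0,\infty)\times\mathbb{R}^n$ and which satisfies the equation at every point there. $W^{k,p}(\mathbb{R}^n)$ norms are taken in the spatial variable $\mathbf{x}$ at fixed $t$. *)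

theory Defs
  imports "HOL-Analysis.Analysis" "HOL-Probability.Essential_Supremum"
begin

section \<open>Partial derivatives and classical solutions\<close>

definition has_partial :: "'n::finite \<Rightarrow> (real^'n \<Rightarrow> 'b::real_normed_vector) \<Rightarrow> real^'n \<Rightarrow> bool" where
  "has_partial j f x \<longleftrightarrow> (\<lambda>h. f (x + h *\<^sub>R axis j 1)) differentiable (at 0)"

definition partial :: "'n::finite \<Rightarrow> (real^'n \<Rightarrow> 'b::real_normed_vector) \<Rightarrow> real^'n \<Rightarrow> 'b" where
  "partial j f x = vector_derivative (\<lambda>h. f (x + h *\<^sub>R axis j 1)) (at 0)"

definition laplacian :: "(real^'n::finite \<Rightarrow> real) \<Rightarrow> real^'n \<Rightarrow> real" where
  "laplacian f x = (\<Sum>j\<in>UNIV. partial j (partial j f) x)"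

definition vec_laplacian :: "(real^'n::finite \<Rightarrow> real^'m::finite) \<Rightarrow> real^'n \<Rightarrow> real^'m" where
  "vec_laplacian f x = (\<chi> i. laplacian (\<lambda>y. f y $ i) x)"

definition convection :: "(real^'n::finite \<Rightarrow> real^'n) \<Rightarrow> real^'n \<Rightarrow> real^'n" where
  "convection v x = jacobian v (at x) *v v x"

text \<open>
  Only the values \<open>u t x\<close> with \<open>t > 0\<close> matter.  The existence of the first-order partial derivatives
  needed for the Laplacian follows from the differentiability of \<open>u t\<close>.
\<close>

definition classical_solution :: "real \<Rightarrow> (real \<Rightarrow> real^'n::finite \<Rightarrow> real^'n) \<Rightarrow> bool" where
  "classical_solution \<mu> u \<longleftrightarrow>
     (\<forall>t>0. \<forall>x. (\<lambda>s. u s x) differentiable (at t)) \<and>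
     (\<forall>t>0. \<forall>x. u t differentiable (at x)) \<and>
     (\<forall>t>0. \<forall>x i j. has_partial j (partial j (\<lambda>y. u t y $ i)) x) \<and>
     continuous_on ({0<..} \<times> UNIV) (\<lambda>(t, x). vector_derivative (\<lambda>s. u s x) (at t)) \<and>
     continuous_on ({0<..} \<times> UNIV) (\<lambda>(t, x). jacobian (u t) (at x)) \<and>
     continuous_on ({0<..} \<times> UNIV) (\<lambda>(t, x). vec_laplacian (u t) x) \<and>
     (\<forall>t>0. \<forall>x. vector_derivative (\<lambda>s. u s x) (at t) + convection (u t) x
                   = \<mu> *\<^sub>R vec_laplacian (u t) x)"

section \<open>Weak derivatives and Sobolev norms\<close>

fun iter_partial :: "'n::finite list \<Rightarrow> (real^'n \<Rightarrow> real) \<Rightarrow> real^'n \<Rightarrow> real" where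
  "iter_partial [] f = f"
| "iter_partial (j # js) f = partial j (iter_partial js f)"

definition test_function :: "(real^'n::finite \<Rightarrow> real) \<Rightarrow> bool" where
  "test_function \<phi> \<longleftrightarrow>
     (\<forall>js x. iter_partial js \<phi> differentiable (at x)) \<and> compact (closure {x. \<phi> x \<noteq> 0})"

definition locally_integrable :: "(real^'n::finite \<Rightarrow> 'b::euclidean_space) \<Rightarrow> bool" where
  "locally_integrable f \<longleftrightarrow> (\<forall>K. compact K \<longrightarrow> set_integrable lebesgue K f)"

text \<open>
  A multi-index is a function \<open>\<alpha> :: 'n \<Rightarrow> nat\<close>, of order \<open>sum \<alpha> UNIV\<close>.  The derivative of a test function
  along \<open>\<alpha>\<close> is its iterated partial derivative along any list in which each index \<open>i\<close> occurs
  \<open>\<alpha> i\<close> times; the order of the list is irrelevant by the symmetry of mixed derivatives.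
\<close>

definition has_weak_deriv ::
    "('n::finite \<Rightarrow> nat) \<Rightarrow> (real^'n \<Rightarrow> 'b::euclidean_space) \<Rightarrow> (real^'n \<Rightarrow> 'b) \<Rightarrow> bool" where
  "has_weak_deriv \<alpha> f g \<longleftrightarrow>
     locally_integrable f \<and> locally_integrable g \<and>
     (\<forall>\<phi> js. test_function \<phi> \<longrightarrow> (\<forall>i. count_list js i = \<alpha> i) \<longrightarrow>
        (\<integral>x. iter_partial js \<phi> x *\<^sub>R f x \<partial>lebesgue)
          = (-1) ^ (\<Sum>i\<in>UNIV. \<alpha> i) *\<^sub>R (\<integral>x. \<phi> x *\<^sub>R g x \<partial>lebesgue))"

definition ennreal_powr :: "ennreal \<Rightarrow> real \<Rightarrow> ennreal" where
  "ennreal_powr x q = (if x = \<infinity> then \<infinity> else ennreal (enn2real x powr q))"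

text \<open>
  The norm is \<open>(\<Sum> |\<alpha>| \<le> k. \<integral> |D^\<alpha> f|^p)^(1/p)\<close>.  Weak derivatives are unique up to null sets, so all
  families \<open>g\<close> of weak derivatives give the same value; if some weak derivative does not exist the index set is
  empty and the infimum is \<open>\<infinity>\<close>.  Thus \<open>f\<close> lies in the Sobolev space iff its norm is finite.
\<close>

definition sobolev_norm :: "nat \<Rightarrow> real \<Rightarrow> (real^'n::finite \<Rightarrow> 'b::euclidean_space) \<Rightarrow> ennreal" where
  "sobolev_norm k p f =
     (INF g \<in> {g. \<forall>\<alpha>. (\<Sum>i\<in>UNIV. \<alpha> i) \<le> k \<longrightarrow> has_weak_deriv \<alpha> f (g \<alpha>)}.
        ennreal_powr (\<Sum>\<alpha> | (\<Sum>i\<in>UNIV. \<alpha> i) \<le> k. \<integral>\<^sup>+x. ennreal (norm (g \<alpha> x) powr p) \<partial>lebesgue) (1 / p))"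

definition Linf_norm :: "(real^'n::finite \<Rightarrow> 'b::euclidean_space) \<Rightarrow> ennreal" where
  "Linf_norm f = esssup lebesgue (\<lambda>x. ennreal (norm (f x)))"

definition cauchy_solution ::
    "nat \<Rightarrow> real \<Rightarrow> real \<Rightarrow> (real^'n::finite \<Rightarrow> real^'n) \<Rightarrow> (real \<Rightarrow> real^'n \<Rightarrow> real^'n) \<Rightarrow> bool" where
  "cauchy_solution k p \<mu> u0 u \<longleftrightarrow>
     classical_solution \<mu> u \<and>
     ((\<lambda>t. sobolev_norm k p (\<lambda>x. u t x - u0 x)) \<longlongrightarrow> 0) (at_right 0)"

section \<open>The explicit solution\<close>

definition ubar_radial :: "nat \<Rightarrow> real \<Rightarrow> real \<Rightarrow> real \<Rightarrow> real \<Rightarrow> real" where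
  "ubar_radial n \<mu> a t r =
     r / (t * (1 + a * (4 * pi * \<mu> * t) powr (real n / 2) * exp (r\<^sup>2 / (4 * \<mu> * t))))"

definition ubar :: "real \<Rightarrow> real \<Rightarrow> real \<Rightarrow> real^'n::finite \<Rightarrow> real^'n" where
  "ubar \<mu> a t x =
     (if x = 0 then 0 else ubar_radial CARD('n) \<mu> a t (norm x) *\<^sub>R ((1 / norm x) *\<^sub>R x))"

end

theory Submission
  imports Defs "HOL-Probability.Distributions"
begin

text \<open>
  Up to a constant, \<open>1/Q\<close> with \<open>Q = a (4 \<pi> \<mu> t)^(n/2) exp (|x|^2 / (4 \<mu> t))\<close> is the heat kernel, and
  \<open>ubar = -2 \<mu> \<nabla> ln (1 + 1/Q)\<close> is the Cole--Hopf transform of the positive solution \<open>1 + 1/Q\<close> of the heat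
  equation; this is why it solves the equation. Since \<open>ubar = (\<sigma>/t) x\<close> with \<open>\<sigma> = 1/(1 + Q)\<close> a logistic
  function of \<open>- ln Q\<close>, all its derivatives are polynomials in \<open>x\<close>, \<open>1/t\<close> and \<open>\<sigma>\<close>, and the equation
  (\<open>ubar_equation\<close>) is an identity between such polynomials.
  
  For small \<open>t\<close> the factor \<open>\<sigma>\<close> is close to \<open>1\<close> on a ball of radius about \<open>sqrt t\<close>, up to a logarithm, and
  negligible outside. There a spatial derivative of order \<open>m\<close> has size \<open>t^(-(1+m)/2)\<close>. For \<open>m = 0\<close> this makes the
  supremum norm blow up, whereas the integral of the \<open>p\<close>-th power is about \<open>t^((n - p (1+m))/2)\<close>, which vanishes in
  the limit precisely when \<open>p < n/(1+m)\<close>. The logarithm is avoided by the inequality \<open>\<sigma> \<le> Q^(-\<theta>)\<close> for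
  \<open>0 \<le> \<theta> \<le> 1\<close> (\<open>\<sigma>_le_powr\<close>): it bounds all derivatives by Gaussians
  (\<open>ubar_derivs_gaussian_bound\<close>) at the cost of a factor \<open>t^(-\<theta>n/2)\<close>, and since the condition on \<open>p\<close> is strict, a
  small \<open>\<theta>\<close> leaves a positive power of \<open>t\<close> (\<open>sobolev_norm_ubar_bound\<close>).
  
  The Sobolev norm is defined by weak derivatives, so one also needs that classical derivatives are weak ones
  (\<open>has_weak_deriv_classical\<close>). This rests on integration by parts, that is on \<open>integral_partial_deriv_eq_0\<close>.
\<close>

section \<open>Partial derivatives and integration by parts\<close>

definition has_partial_deriv ::
    "'n::finite \<Rightarrow> (real^'n \<Rightarrow> 'b::real_normed_vector) \<Rightarrow> (real^'n \<Rightarrow> 'b) \<Rightarrow> bool" where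
  "has_partial_deriv j f g \<longleftrightarrow>
     (\<forall>x. ((\<lambda>h. f (x + h *\<^sub>R axis j 1)) has_vector_derivative g x) (at 0))"

lemma has_partial_derivD: "has_partial_deriv j f g \<Longrightarrow> partial j f = g"
  by (auto simp: has_partial_deriv_def partial_def vector_derivative_at fun_eq_iff)

lemma has_partial_deriv_imp_has_partial: "has_partial_deriv j f g \<Longrightarrow> has_partial j f x"
  by (auto simp: has_partial_deriv_def has_partial_def intro: differentiableI_vector)

lemma has_derivative_imp_has_partial_deriv:
  fixes f :: "real^'n::finite \<Rightarrow> 'b::real_normed_vector" and j :: 'n
  assumes "\<And>x. (f has_derivative D x) (at x)"
  shows "has_partial_deriv j f (\<lambda>x. D x (axis j 1))"
  unfolding has_partial_deriv_def
proof
  fix x :: "real^'n"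
  have 1: "((\<lambda>h. x + h *\<^sub>R axis j (1::real)) has_derivative (\<lambda>h. h *\<^sub>R axis j 1)) (at 0)"
    by (auto intro!: derivative_eq_intros)
  have "((\<lambda>h. f (x + h *\<^sub>R axis j 1)) has_derivative (\<lambda>h. D x (h *\<^sub>R axis j 1))) (at 0)"
    using has_derivative_compose[OF 1, of f "D x"] assms[of x] by simp
  moreover have "linear (D x)" using assms[of x] by (rule has_derivative_linear)
  ultimately show "((\<lambda>h. f (x + h *\<^sub>R axis j 1)) has_vector_derivative D x (axis j 1)) (at 0)"
    by (simp add: has_vector_derivative_def linear_cmul)
qed

lemma has_partial_deriv_along_line:
  assumes "has_partial_deriv j f g"
  shows "((\<lambda>h. f (x + h *\<^sub>R axis j 1)) has_vector_derivative g (x + r *\<^sub>R axis j 1)) (at r)"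
proof -
  have "((\<lambda>h. f ((x + r *\<^sub>R axis j 1) + h *\<^sub>R axis j 1)) has_vector_derivative g (x + r *\<^sub>R axis j 1)) (at (r - r))"
    using assms by (simp add: has_partial_deriv_def)
  moreover have "((\<lambda>s. s - r) has_vector_derivative 1) (at r)"
    by (auto intro!: derivative_eq_intros)
  ultimately have "(((\<lambda>h. f ((x + r *\<^sub>R axis j 1) + h *\<^sub>R axis j 1)) \<circ> (\<lambda>s. s - r))
      has_vector_derivative 1 *\<^sub>R g (x + r *\<^sub>R axis j 1)) (at r)"
    by (intro vector_diff_chain_at) auto
  then show ?thesis
    by (simp add: o_def algebra_simps)
qed

lemma has_vector_derivative_at_0_imp_quotient_tendsto:
  fixes F :: "real \<Rightarrow> 'b::real_normed_vector"
  assumes "(F has_vector_derivative D) (at 0)"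
  shows "((\<lambda>h. (F h - F 0) /\<^sub>R h) \<longlongrightarrow> D) (at 0)"
proof -
  have "((\<lambda>h. norm (F h - F 0 - h *\<^sub>R D) / norm h) \<longlongrightarrow> 0) (at 0)"
    using assms by (simp add: has_vector_derivative_def has_derivative_at)
  also have "?this \<longleftrightarrow> ((\<lambda>h. norm ((F h - F 0) /\<^sub>R h - D)) \<longlongrightarrow> 0) (at 0)"
  proof (rule tendsto_cong, unfold eventually_at_filter, intro always_eventually allI impI)
    fix h :: real assume "h \<noteq> 0"
    then have "(F h - F 0) /\<^sub>R h - D = (F h - F 0 - h *\<^sub>R D) /\<^sub>R h"
      by (simp add: scaleR_diff_right)
    then show "norm (F h - F 0 - h *\<^sub>R D) / norm h = norm ((F h - F 0) /\<^sub>R h - D)"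
      by (simp add: divide_inverse mult.commute)
  qed
  finally show ?thesis
    by (metis tendsto_norm_zero_iff LIM_zero_iff)
qed

lemma has_partial_deriv_vanishes:
  assumes "has_partial_deriv j f g" "closed K" "\<And>x. x \<notin> K \<Longrightarrow> f x = 0" "x \<notin> K"
  shows "g x = 0"
proof -
  have "eventually (\<lambda>h. x + h *\<^sub>R axis j 1 \<in> - K) (at (0::real))"
  proof -
    have "((\<lambda>h::real. x + h *\<^sub>R axis j 1) \<longlongrightarrow> x + 0 *\<^sub>R axis j 1) (at 0)"
      by (intro tendsto_intros)
    then show ?thesis
      using assms(2,4) by (intro topological_tendstoD) (auto simp: open_Compl)
  qed
  then have "eventually (\<lambda>h. f (x + h *\<^sub>R axis j 1) = 0) (at (0::real))"
    by eventually_elim (use assms(3) in auto)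
  moreover have "((\<lambda>h. f (x + h *\<^sub>R axis j 1)) has_vector_derivative g x) (at 0)"
    using assms(1) by (simp add: has_partial_deriv_def)
  ultimately have "((\<lambda>h::real. 0) has_vector_derivative g x) (at 0)"
    using assms(3,4) unfolding has_vector_derivative_def
    by (elim has_derivative_transform_eventually) auto
  moreover have "((\<lambda>h::real. 0) has_vector_derivative (0::'b)) (at 0)"
    by simp
  ultimately show ?thesis
    by (metis vector_derivative_at)
qed

lemma continuous_compact_support_integrable:
  fixes f :: "'a::euclidean_space \<Rightarrow> 'b::euclidean_space"
  assumes "continuous_on UNIV f" "compact K" "\<And>x. x \<notin> K \<Longrightarrow> f x = 0"
  shows "integrable lborel f"
proof -
  have "integrable lborel (\<lambda>x. indicator K x *\<^sub>R f x)"
    using assms by (intro borel_integrable_compact) (auto intro: continuous_on_subset)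
  also have "(\<lambda>x. indicator K x *\<^sub>R f x) = f"
    using assms(3) by (auto simp: indicator_def)
  finally show ?thesis .
qed

lemma lborel_integral_translate:
  fixes f :: "'a::euclidean_space \<Rightarrow> 'b::euclidean_space"
  assumes "f \<in> borel_measurable borel"
  shows "(\<integral>x. f (x + c) \<partial>lborel) = (\<integral>x. f x \<partial>lborel)"
proof -
  have "(\<integral>x. f x \<partial>lborel) = (\<integral>x. f x \<partial>(distr lborel borel ((+) c)))"
    by (simp add: lborel_distr_plus)
  also have "\<dots> = (\<integral>x. f (c + x) \<partial>lborel)"
    using assms by (subst integral_distr) auto
  finally show ?thesis by (simp add: add.commute)
qed

text \<open>
  The integral of \<open>f (x + s e)\<close> does not depend on \<open>s\<close>, because Lebesgue measure is translation invariant; so its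
  derivative in \<open>s\<close>, which is the integral of \<open>g\<close>, vanishes. Differentiation under the integral is dominated
  convergence for the difference quotients: by the mean value inequality they are bounded by the supremum of \<open>|g|\<close>, and
  for \<open>s \<le> 1\<close> they are supported in one fixed ball.
\<close>

lemma integral_partial_deriv_eq_0:
  fixes f g :: "real^'n::finite \<Rightarrow> 'b::euclidean_space"
  assumes der: "has_partial_deriv j f g"
    and cont: "continuous_on UNIV f" "continuous_on UNIV g"
    and K: "compact K" "\<And>x. x \<notin> K \<Longrightarrow> f x = 0"
  shows "(\<integral>x. g x \<partial>lborel) = 0"
proof -
  let ?e = "axis j 1 :: real^'n"
  define s :: "nat \<Rightarrow> real" where "s n = inverse (real (Suc n))" for n
  define q where "q n x = (1 / s n) *\<^sub>R (f (x + s n *\<^sub>R ?e) - f x)" for n x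
  have s: "0 < s n" "s n \<le> 1" for n by (auto simp: s_def field_simps)
  have g0: "g x = 0" if "x \<notin> K" for x
    using has_partial_deriv_vanishes[OF der _ K(2) that] K(1) by (auto intro: compact_imp_closed)
  have "bounded (g ` K)"
    using K(1) cont(2) by (auto intro!: compact_imp_bounded compact_continuous_image intro: continuous_on_subset)
  then obtain B where B: "B > 0" "\<And>x. x \<in> K \<Longrightarrow> norm (g x) \<le> B"
    by (auto simp: bounded_pos)
  have gB: "norm (g x) \<le> B" for x
    using B g0[of x] by (cases "x \<in> K") auto
  obtain R where R: "\<And>x. x \<in> K \<Longrightarrow> norm x \<le> R"
    using compact_imp_bounded[OF K(1)] by (auto simp: bounded_iff)
  \<comment> \<open>The support of a quotient with step at most 1 sticks out of the support of f by at most 1.\<close>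
  let ?C = "cball (0::real^'n) (R + 1)"
  have qB: "norm (q n x) \<le> indicator ?C x *\<^sub>R B" for n x
  proof (cases "x \<in> ?C")
    case True
    have "norm (f (x + s n *\<^sub>R ?e) - f (x + 0 *\<^sub>R ?e)) \<le> B * norm (s n - 0)"
    proof (rule differentiable_bound[of UNIV _ "\<lambda>r h. h *\<^sub>R g (x + r *\<^sub>R ?e)"])
      show "((\<lambda>h. f (x + h *\<^sub>R ?e)) has_derivative (\<lambda>h. h *\<^sub>R g (x + r *\<^sub>R ?e))) (at r)" for r
        using has_partial_deriv_along_line[OF der, of x r] by (simp add: has_vector_derivative_def)
      show "onorm (\<lambda>h. h *\<^sub>R g (x + r *\<^sub>R ?e)) \<le> B" for r
        by (rule onorm_le) (auto simp: mult.commute[of B] intro: mult_left_mono gB)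
    qed auto
    then have "norm (f (x + s n *\<^sub>R ?e) - f x) / s n \<le> B"
      using s[of n] by (simp add: field_simps)
    then show ?thesis using True s[of n] by (simp add: q_def)
  next
    case False
    have "x \<notin> K" using False R[of x] by auto
    moreover have "x + s n *\<^sub>R ?e \<notin> K"
    proof
      assume "x + s n *\<^sub>R ?e \<in> K"
      then have "norm (x + s n *\<^sub>R ?e) \<le> R" by (rule R)
      moreover have "norm x \<le> norm (x + s n *\<^sub>R ?e) + norm (s n *\<^sub>R ?e)"
        by (metis add_diff_cancel_right' norm_triangle_ineq4)
      moreover have "norm (s n *\<^sub>R ?e) \<le> 1" using s[of n] by simp
      ultimately show False using False by simp
    qed
    ultimately show ?thesis using K(2) B(1) by (simp add: q_def indicator_def)
  qed
  have mf[measurable]: "f \<in> borel_measurable borel" "g \<in> borel_measurable borel"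
    using cont by (auto intro: borel_measurable_continuous_onI)
  have fi: "integrable lborel f"
    by (rule continuous_compact_support_integrable[OF cont(1) K])
  have "(\<lambda>n. \<integral>x. q n x \<partial>lborel) \<longlonglongrightarrow> (\<integral>x. g x \<partial>lborel)"
  proof (rule integral_dominated_convergence)
    show "integrable lborel (\<lambda>x. indicator ?C x *\<^sub>R B)"
      by (intro borel_integrable_compact) auto
    show "AE x in lborel. (\<lambda>n. q n x) \<longlonglongrightarrow> g x"
    proof (intro always_eventually allI)
      fix x
      have lim: "filterlim s (at 0) sequentially"
        unfolding filterlim_at using s(1) LIMSEQ_inverse_real_of_nat
        by (auto simp: s_def[abs_def] simp del: of_nat_Suc) 
      have "((\<lambda>h. (f (x + h *\<^sub>R ?e) - f x) /\<^sub>R h) \<longlongrightarrow> g x) (at 0)"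
        using has_vector_derivative_at_0_imp_quotient_tendsto
          der[unfolded has_partial_deriv_def, rule_format, of x] by fastforce
      from filterlim_compose[OF this lim] show "(\<lambda>n. q n x) \<longlonglongrightarrow> g x"
        by (simp add: q_def divide_inverse)
    qed
    show "AE x in lborel. norm (q n x) \<le> indicator ?C x *\<^sub>R B" for n
      using qB by simp
    show "q n \<in> borel_measurable lborel" for n unfolding q_def by measurable
  qed auto
  moreover have "(\<integral>x. q n x \<partial>lborel) = 0" for n
  proof -
    have "integrable lborel (\<lambda>x. f (x + s n *\<^sub>R ?e))"
    proof (rule continuous_compact_support_integrable)
      show "compact ((\<lambda>x. x - s n *\<^sub>R ?e) ` K)"
        by (intro compact_continuous_image K continuous_intros)
      show "f (x + s n *\<^sub>R ?e) = 0" if "x \<notin> (\<lambda>x. x - s n *\<^sub>R ?e) ` K" for x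
        using that by (intro K(2)) (auto simp: image_iff algebra_simps)
      show "continuous_on UNIV (\<lambda>x. f (x + s n *\<^sub>R ?e))"
        by (rule continuous_on_compose2[OF cont(1)]) (auto intro!: continuous_intros)
    qed
    then show ?thesis
      using fi lborel_integral_translate[OF mf(1), of "s n *\<^sub>R ?e"] by (simp add: q_def)
  qed
  ultimately show ?thesis by (simp add: LIMSEQ_const_iff)
qed

lemma has_partial_deriv_scaleR:
  assumes "has_partial_deriv j \<phi> \<phi>'" "has_partial_deriv j f g"
  shows "has_partial_deriv j (\<lambda>x. \<phi> x *\<^sub>R f x) (\<lambda>x. \<phi> x *\<^sub>R g x + \<phi>' x *\<^sub>R f x)"
  unfolding has_partial_deriv_def
proof
  fix x
  have "((\<lambda>h. \<phi> (x + h *\<^sub>R axis j 1)) has_vector_derivative \<phi>' x) (at 0)"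
    "((\<lambda>h. f (x + h *\<^sub>R axis j 1)) has_vector_derivative g x) (at 0)"
    using assms by (auto simp: has_partial_deriv_def)
  then show "((\<lambda>h. \<phi> (x + h *\<^sub>R axis j 1) *\<^sub>R f (x + h *\<^sub>R axis j 1)) has_vector_derivative
      \<phi> x *\<^sub>R g x + \<phi>' x *\<^sub>R f x) (at 0)"
    using has_vector_derivative_scaleR[of "\<lambda>h. \<phi> (x + h *\<^sub>R axis j 1)" "\<phi>' x" 0 UNIV
        "\<lambda>h. f (x + h *\<^sub>R axis j 1)" "g x"]
    by (simp add: has_real_derivative_iff_has_vector_derivative)
qed

lemma integration_by_parts:
  fixes f g :: "real^'n::finite \<Rightarrow> 'b::euclidean_space"
  assumes der: "has_partial_deriv j \<phi> \<phi>'" "has_partial_deriv j f g"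
    and cont: "continuous_on UNIV \<phi>" "continuous_on UNIV \<phi>'" "continuous_on UNIV f" "continuous_on UNIV g"
    and K: "compact K" "\<And>x. x \<notin> K \<Longrightarrow> \<phi> x = 0"
  shows "(\<integral>x. \<phi>' x *\<^sub>R f x \<partial>lborel) = - (\<integral>x. \<phi> x *\<^sub>R g x \<partial>lborel)"
proof -
  have \<phi>'0: "\<phi>' x = 0" if "x \<notin> K" for x
    using has_partial_deriv_vanishes[OF der(1) _ K(2) that] K(1) by (auto intro: compact_imp_closed)
  have "(\<integral>x. \<phi> x *\<^sub>R g x + \<phi>' x *\<^sub>R f x \<partial>lborel) = 0"
    using K by (intro integral_partial_deriv_eq_0[OF has_partial_deriv_scaleR[OF der], of K])
      (auto intro!: continuous_intros cont)
  moreover have "integrable lborel (\<lambda>x. \<phi> x *\<^sub>R g x)" "integrable lborel (\<lambda>x. \<phi>' x *\<^sub>R f x)"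
    using K \<phi>'0 by (auto intro!: continuous_compact_support_integrable[of _ K] continuous_intros cont)
  ultimately show ?thesis by (simp add: eq_neg_iff_add_eq_0 add.commute)
qed

lemma test_function_has_partial_deriv:
  assumes "test_function \<phi>"
  shows "has_partial_deriv j (iter_partial js \<phi>) (iter_partial (j # js) \<phi>)"
proof -
  define D where "D x = frechet_derivative (iter_partial js \<phi>) (at x)" for x
  have "(iter_partial js \<phi> has_derivative D x) (at x)" for x
    using assms unfolding test_function_def D_def by (simp add: frechet_derivative_works)
  from has_derivative_imp_has_partial_deriv[OF this, where j=j]
  show ?thesis by (metis has_partial_derivD iter_partial.simps(2))
qed

lemma test_function_continuous:
  assumes "test_function \<phi>"
  shows "continuous_on UNIV (iter_partial js \<phi>)"
  using assms unfolding test_function_def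
  by (auto intro!: continuous_at_imp_continuous_on differentiable_imp_continuous_within)

lemma test_function_vanishes:
  assumes "test_function \<phi>" "x \<notin> closure {x. \<phi> x \<noteq> 0}"
  shows "iter_partial js \<phi> x = 0"
  using assms(2)
proof (induction js arbitrary: x)
  case Nil
  then show ?case using closure_subset[of "{x. \<phi> x \<noteq> 0}"] by auto
next
  case (Cons j js)
  show ?case
    by (rule has_partial_deriv_vanishes[OF test_function_has_partial_deriv[OF assms(1)] closed_closure Cons.IH Cons.prems])
qed

text \<open>
  Each integration by parts moves the outermost partial derivative from the test function to \<open>G\<close>; this is why the
  derivatives arrive at \<open>G\<close> in reversed order.
\<close>

lemma integral_iter_partial:
  fixes G :: "'n::finite list \<Rightarrow> real^'n \<Rightarrow> 'b::euclidean_space"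
  assumes \<phi>: "test_function \<phi>"
    and der: "\<And>j js. length js < k \<Longrightarrow> has_partial_deriv j (G js) (G (j # js))"
    and cont: "\<And>js. length js \<le> k \<Longrightarrow> continuous_on UNIV (G js)"
  shows "length js + length ks \<le> k \<Longrightarrow>
    (\<integral>x. iter_partial js \<phi> x *\<^sub>R G ks x \<partial>lborel)
      = (-1) ^ length js *\<^sub>R (\<integral>x. \<phi> x *\<^sub>R G (rev js @ ks) x \<partial>lborel)"
proof (induction js arbitrary: ks)
  case (Cons j js)
  have "(\<integral>x. iter_partial (j # js) \<phi> x *\<^sub>R G ks x \<partial>lborel)
      = - (\<integral>x. iter_partial js \<phi> x *\<^sub>R G (j # ks) x \<partial>lborel)"
    using Cons.prems \<phi>
    by (intro integration_by_parts[where K="closure {x. \<phi> x \<noteq> 0}" and j=j] test_function_has_partial_deriv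
        test_function_continuous der cont test_function_vanishes)
      (auto simp: test_function_def)
  also have "(\<integral>x. iter_partial js \<phi> x *\<^sub>R G (j # ks) x \<partial>lborel)
      = (-1) ^ length js *\<^sub>R (\<integral>x. \<phi> x *\<^sub>R G (rev js @ j # ks) x \<partial>lborel)"
    using Cons.prems by (intro Cons.IH) auto
  finally show ?case by simp
qed simp

lemma locally_integrable_continuous:
  fixes f :: "real^'n::finite \<Rightarrow> 'b::euclidean_space"
  assumes "continuous_on UNIV f"
  shows "locally_integrable f"
  unfolding locally_integrable_def set_integrable_def
proof (intro allI impI)
  fix K :: "(real^'n) set" assume "compact K"
  then have "integrable lborel (\<lambda>x. indicator K x *\<^sub>R f x)"
    using assms by (intro borel_integrable_compact) (auto intro: continuous_on_subset)
  then show "integrable lebesgue (\<lambda>x. indicator K x *\<^sub>R f x)"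
    by (subst integrable_completion) (auto simp: integrable_iff_bounded)
qed

text \<open>
  Iterated derivatives are indexed by lists, weak derivatives by multi-indices. Any list with the prescribed
  multiplicities will do where the derivatives do not depend on the order of differentiation.
\<close>

definition list_of_multi_index :: "('n::finite \<Rightarrow> nat) \<Rightarrow> 'n list" where
  "list_of_multi_index \<alpha> = (SOME js. mset js = (\<Sum>i\<in>UNIV. replicate_mset (\<alpha> i) i))"

lemma mset_list_of_multi_index:
  "mset (list_of_multi_index \<alpha>) = (\<Sum>i\<in>UNIV. replicate_mset (\<alpha> i) i)"
  unfolding list_of_multi_index_def by (rule someI_ex) (rule ex_mset)

lemma length_list_of_multi_index: "length (list_of_multi_index \<alpha>) = (\<Sum>i\<in>UNIV. \<alpha> i)"
  by (simp flip: size_mset add: mset_list_of_multi_index)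

lemma mset_eq_list_of_multi_index:
  assumes "\<And>i. count_list js i = \<alpha> i"
  shows "mset js = mset (list_of_multi_index \<alpha>)"
  by (rule multiset_eqI) (simp add: mset_list_of_multi_index count_sum assms count_mset)

text \<open>
  The weak derivative is tested against iterated derivatives of test functions in every order with the given
  multiplicities; the symmetry of \<open>G\<close> makes one and the same function fit all of them.
\<close>

lemma has_weak_deriv_classical:
  fixes G :: "'n::finite list \<Rightarrow> real^'n \<Rightarrow> 'b::euclidean_space"
  assumes der: "\<And>j js. length js < k \<Longrightarrow> has_partial_deriv j (G js) (G (j # js))"
    and cont: "\<And>js. length js \<le> k \<Longrightarrow> continuous_on UNIV (G js)"
    and sym: "\<And>js ks. mset js = mset ks \<Longrightarrow> G js = G ks"
    and "(\<Sum>i\<in>UNIV. \<alpha> i) \<le> k"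
  shows "has_weak_deriv \<alpha> (G []) (G (list_of_multi_index \<alpha>))"
  unfolding has_weak_deriv_def
proof (intro conjI allI impI)
  show "locally_integrable (G [])" "locally_integrable (G (list_of_multi_index \<alpha>))"
    using assms(4) by (auto intro!: locally_integrable_continuous cont simp: length_list_of_multi_index)
next
  fix \<phi> :: "real^'n \<Rightarrow> real" and js
  assume \<phi>: "test_function \<phi>" and js: "\<forall>i. count_list js i = \<alpha> i"
  then have ms: "mset js = mset (list_of_multi_index \<alpha>)"
    by (intro mset_eq_list_of_multi_index) auto
  then have len: "length js = (\<Sum>i\<in>UNIV. \<alpha> i)"
    by (metis length_list_of_multi_index size_mset)
  have [measurable]: "G [] \<in> borel_measurable borel" "G (list_of_multi_index \<alpha>) \<in> borel_measurable borel"
    "iter_partial js \<phi> \<in> borel_measurable borel" "\<phi> \<in> borel_measurable borel"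
    using assms(4) test_function_continuous[OF \<phi>] test_function_continuous[OF \<phi>, of "[]"]
    by (auto intro!: borel_measurable_continuous_onI cont simp: length_list_of_multi_index)
  have "(\<integral>x. iter_partial js \<phi> x *\<^sub>R G [] x \<partial>lborel)
      = (-1) ^ length js *\<^sub>R (\<integral>x. \<phi> x *\<^sub>R G (rev js @ []) x \<partial>lborel)"
    using assms(4) len by (intro integral_iter_partial[where k=k] \<phi> der cont) auto
  also have "G (rev js @ []) = G (list_of_multi_index \<alpha>)"
    using ms by (intro sym) simp
  finally show "(\<integral>x. iter_partial js \<phi> x *\<^sub>R G [] x \<partial>lebesgue)
      = (-1) ^ (\<Sum>i\<in>UNIV. \<alpha> i) *\<^sub>R (\<integral>x. \<phi> x *\<^sub>R G (list_of_multi_index \<alpha>) x \<partial>lebesgue)"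
    by (simp add: integral_completion len)
qed

lemma ennreal_powr_mono:
  assumes "x \<le> y" "0 \<le> q"
  shows "ennreal_powr x q \<le> ennreal_powr y q"
  using assms by (cases x; cases y) (auto simp: ennreal_powr_def top_unique intro!: ennreal_leI powr_mono2)

lemma sobolev_norm_le:
  fixes G :: "'n::finite list \<Rightarrow> real^'n \<Rightarrow> 'b::euclidean_space"
  assumes der: "\<And>j js. length js < k \<Longrightarrow> has_partial_deriv j (G js) (G (j # js))"
    and cont: "\<And>js. length js \<le> k \<Longrightarrow> continuous_on UNIV (G js)"
    and sym: "\<And>js ks. mset js = mset ks \<Longrightarrow> G js = G ks"
    and p: "p > 0"
    and bound: "\<And>js. length js \<le> k \<Longrightarrow> (\<integral>\<^sup>+x. ennreal (norm (G js x) powr p) \<partial>lborel) \<le> ennreal B"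
    and "B \<ge> 0"
  shows "sobolev_norm k p (G []) \<le>
    ennreal ((real (card {\<alpha>::'n \<Rightarrow> nat. (\<Sum>i\<in>UNIV. \<alpha> i) \<le> k}) * B) powr (1 / p))"
proof -
  let ?I = "{\<alpha>::'n \<Rightarrow> nat. (\<Sum>i\<in>UNIV. \<alpha> i) \<le> k}"
  let ?g = "\<lambda>\<alpha>. G (list_of_multi_index \<alpha>)"
  have "sobolev_norm k p (G []) \<le>
      ennreal_powr (\<Sum>\<alpha>\<in>?I. \<integral>\<^sup>+x. ennreal (norm (?g \<alpha> x) powr p) \<partial>lebesgue) (1 / p)"
    unfolding sobolev_norm_def
    by (rule INF_lower) (auto intro!: has_weak_deriv_classical[where k=k] der cont sym)
  also have "\<dots> \<le> ennreal_powr (of_nat (card ?I) * ennreal B) (1 / p)"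
  proof (intro ennreal_powr_mono sum_bounded_above)
    fix \<alpha> :: "'n \<Rightarrow> nat" assume "\<alpha> \<in> ?I"
    then have len: "length (list_of_multi_index \<alpha>) \<le> k" by (simp add: length_list_of_multi_index)
    then have [measurable]: "?g \<alpha> \<in> borel_measurable borel"
      by (intro borel_measurable_continuous_onI cont)
    show "(\<integral>\<^sup>+x. ennreal (norm (?g \<alpha> x) powr p) \<partial>lebesgue) \<le> ennreal B"
      using bound[OF len] by (subst nn_integral_completion) auto
  qed (use p in auto)
  also have "of_nat (card ?I) * ennreal B = ennreal (real (card ?I) * B)"
    using \<open>B \<ge> 0\<close> by (simp add: ennreal_mult ennreal_of_nat_eq_real_of_nat)
  also have "ennreal_powr \<dots> (1 / p) = ennreal ((real (card ?I) * B) powr (1 / p))"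
    using \<open>B \<ge> 0\<close> by (simp add: ennreal_powr_def)
  finally show ?thesis .
qed

section \<open>The essential supremum of a continuous function\<close>

text \<open>
  The set where \<open>|f|\<close> is at most its essential supremum is closed and has a null complement; a closed set with null
  complement is everything, since non-empty open sets have positive measure.
\<close>

lemma Linf_norm_ge:
  fixes f :: "real^'n::finite \<Rightarrow> 'b::euclidean_space"
  assumes "continuous_on UNIV f"
  shows "ennreal (norm (f x)) \<le> Linf_norm f"
proof -
  have "closed {y. ennreal (norm (f y)) \<le> Linf_norm f}"
    by (rule closed_Collect_le) (intro continuous_intros continuous_on_ennreal assms)+
  moreover have "AE y in lebesgue. y \<in> {y. ennreal (norm (f y)) \<le> Linf_norm f}"
    using esssup_AE[of "\<lambda>y. ennreal (norm (f y))" lebesgue] by (simp add: Linf_norm_def)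
  ultimately show ?thesis
    using mem_closed_if_AE_lebesgue by blast
qed

section \<open>Gaussian integrals\<close>

lemma nn_integral_gaussian_real:
  assumes "c > 0"
  shows "(\<integral>\<^sup>+x. ennreal (exp (- c * x\<^sup>2)) \<partial>lborel) = ennreal (sqrt (pi / c))"
proof -
  have "exp (- c * x\<^sup>2) = sqrt (pi / c) * normal_density 0 (sqrt (1 / (2 * c))) x" for x
    using assms by (simp add: normal_density_def real_sqrt_divide field_simps)
  then have "(\<integral>\<^sup>+x. ennreal (exp (- c * x\<^sup>2)) \<partial>lborel)
      = (\<integral>\<^sup>+x. ennreal (sqrt (pi / c)) * ennreal (normal_density 0 (sqrt (1 / (2 * c))) x) \<partial>lborel)"
    using assms by (simp add: ennreal_mult)
  also have "\<dots> = ennreal (sqrt (pi / c)) * (\<integral>\<^sup>+x. ennreal (normal_density 0 (sqrt (1 / (2 * c))) x) \<partial>lborel)"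
    by (rule nn_integral_cmult) measurable
  also have "(\<integral>\<^sup>+x. ennreal (normal_density 0 (sqrt (1 / (2 * c))) x) \<partial>lborel) = ennreal 1"
    using assms by (subst nn_integral_eq_integral) (auto simp: integrable_normal_density integral_normal_density)
  finally show ?thesis by simp
qed

lemma nn_integral_gaussian:
  assumes "c > 0"
  shows "(\<integral>\<^sup>+x. ennreal (exp (- c * (norm (x::'a::euclidean_space))\<^sup>2)) \<partial>lborel)
    = ennreal (sqrt (pi / c) ^ DIM('a))"
proof -
  have "ennreal (exp (- c * (norm x)\<^sup>2)) = (\<Prod>b\<in>Basis. ennreal (exp (- c * (x \<bullet> b)\<^sup>2)))" for x :: 'a
  proof -
    have "(norm x)\<^sup>2 = (\<Sum>b\<in>Basis. (x \<bullet> b)\<^sup>2)"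
      by (subst power2_norm_eq_inner, subst euclidean_inner) (simp add: power2_eq_square)
    then show ?thesis
      by (simp add: prod_ennreal sum_distrib_left sum_negf[symmetric] exp_sum)
  qed
  then show ?thesis
    using assms nn_integral_gaussian_real[OF assms]
      nn_integral_lborel_prod[where f="\<lambda>(b::'a) y. ennreal (exp (- c * y\<^sup>2))"]
    by (simp add: ennreal_power)
qed

text \<open>
  Half of the Gaussian decay pays for the polynomial factors that arise when \<open>ubar\<close> is differentiated; the power
  \<open>(1 + y^2)^2\<close> dominates all those of degree at most three.
\<close>

lemma polynomial_times_gaussian_bounded:
  fixes c :: real
  assumes "c > 0"
  shows "\<exists>C>0. \<forall>y. (1 + y\<^sup>2)\<^sup>2 * exp (- 2 * c * y\<^sup>2) \<le> C * exp (- c * y\<^sup>2)"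
proof (intro exI[of _ "(max 1 (2 / c))\<^sup>2"] conjI allI)
  fix y :: real
  \<comment> \<open>With this K one has 1 + y^2 <= K (1 + c y^2 / 2), and the second factor is at most exp (c y^2 / 2).\<close>
  define K where "K = max 1 (2 / c)"
  have K: "1 \<le> K" "1 \<le> K * (c / 2)" using assms by (auto simp: K_def max_def field_simps)
  have "1 + y\<^sup>2 \<le> K + K * (c / 2) * y\<^sup>2"
    using K mult_right_mono[OF K(2), of "y\<^sup>2"] by simp
  also have "\<dots> = K * (1 + c / 2 * y\<^sup>2)" by (simp add: algebra_simps)
  also have "\<dots> \<le> K * exp (c / 2 * y\<^sup>2)"
    using K by (intro mult_left_mono exp_ge_add_one_self) auto
  finally have "(1 + y\<^sup>2)\<^sup>2 \<le> (K * exp (c / 2 * y\<^sup>2))\<^sup>2"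
    by (intro power_mono) auto
  also have "\<dots> = K\<^sup>2 * exp (c * y\<^sup>2)"
    by (simp add: power_mult_distrib exp_double[symmetric])
  finally have "(1 + y\<^sup>2)\<^sup>2 * exp (- 2 * c * y\<^sup>2) \<le> K\<^sup>2 * exp (c * y\<^sup>2) * exp (- 2 * c * y\<^sup>2)"
    by (rule mult_right_mono) simp
  also have "\<dots> = K\<^sup>2 * exp (- c * y\<^sup>2)"
    by (simp add: mult.assoc exp_add[symmetric])
  finally show "(1 + y\<^sup>2)\<^sup>2 * exp (- 2 * c * y\<^sup>2) \<le> (max 1 (2 / c))\<^sup>2 * exp (- c * y\<^sup>2)"
    by (simp add: K_def)
qed simp

section \<open>The explicit solution of the equation\<close>

lemma list_length_cases:
  obtains "js = []" | j where "js = [j]" | j k where "js = [j, k]" | "length js > 2"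
proof (cases js)
  case (Cons j js')
  note 1 = Cons
  show ?thesis
  proof (cases js')
    case (Cons k js'')
    then show ?thesis using 1 that(3,4) by (cases js'') auto
  qed (use 1 that in auto)
qed (use that in auto)

locale burgers_parameters =
  fixes \<mu> a :: real
  assumes \<mu>: "\<mu> > 0" and a: "a > 0"
begin

definition Q :: "real \<Rightarrow> real^'n::finite \<Rightarrow> real" where
  "Q t x = a * (4 * pi * \<mu> * t) powr (real CARD('n) / 2) * exp ((norm x)\<^sup>2 / (4 * \<mu> * t))"

text \<open>
  As a function of \<open>ln Q\<close>, \<open>\<sigma>\<close> satisfies the logistic equation \<open>d\<sigma>/d(ln Q) = - \<sigma> (1 - \<sigma>)\<close>. Thus \<open>\<sigma>1\<close> and
  \<open>\<sigma>2\<close> are, with the sign convention \<open>\<sigma>1 = - d\<sigma>/d(ln Q)\<close> and \<open>\<sigma>2 = - d\<sigma>1/d(ln Q)\<close>, the successive derivatives of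
  \<open>\<sigma>\<close>. By the chain rule every derivative below comes from \<open>\<nabla> ln Q = x / (2 \<mu> t)\<close> and
  \<open>\<partial>_t ln Q = n / (2 t) - |x|^2 / (4 \<mu> t^2)\<close>.
\<close>

definition \<sigma> :: "real \<Rightarrow> real^'n::finite \<Rightarrow> real" where
  "\<sigma> t x = 1 / (1 + Q t x)"

definition \<sigma>1 :: "real \<Rightarrow> real^'n::finite \<Rightarrow> real" where
  "\<sigma>1 t x = \<sigma> t x * (1 - \<sigma> t x)"

definition \<sigma>2 :: "real \<Rightarrow> real^'n::finite \<Rightarrow> real" where
  "\<sigma>2 t x = \<sigma>1 t x * (1 - 2 * \<sigma> t x)"

definition ubar_deriv1 :: "'n \<Rightarrow> real \<Rightarrow> real^'n::finite \<Rightarrow> real^'n" where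
  "ubar_deriv1 j t x = (\<sigma> t x / t) *\<^sub>R axis j 1 - (\<sigma>1 t x * (x $ j) / (2 * \<mu> * t\<^sup>2)) *\<^sub>R x"

definition ubar_deriv2 :: "'n \<Rightarrow> 'n \<Rightarrow> real \<Rightarrow> real^'n::finite \<Rightarrow> real^'n" where
  "ubar_deriv2 j k t x =
     (\<sigma>2 t x * (x $ j) * (x $ k) / (4 * \<mu>\<^sup>2 * t ^ 3)) *\<^sub>R x
     - (\<sigma>1 t x / (2 * \<mu> * t\<^sup>2)) *\<^sub>R ((x $ j) *\<^sub>R axis k 1 + (x $ k) *\<^sub>R axis j 1 + (if j = k then x else 0))"

definition ubar_time_deriv :: "real \<Rightarrow> real^'n::finite \<Rightarrow> real^'n" where
  "ubar_time_deriv t x = - (\<sigma> t x / t\<^sup>2 + \<sigma>1 t x / t * (real CARD('n) / (2 * t) - (norm x)\<^sup>2 / (4 * \<mu> * t\<^sup>2))) *\<^sub>R x"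

lemma ubar_eq: "ubar \<mu> a t x = (\<sigma> t x / t) *\<^sub>R x"
  by (simp add: ubar_def ubar_radial_def \<sigma>_def Q_def)

lemma Q_pos: "t > 0 \<Longrightarrow> Q t x > 0"
  using \<mu> a by (simp add: Q_def)

lemma \<sigma>1_eq: "t > 0 \<Longrightarrow> \<sigma>1 t x = Q t x / (1 + Q t x)\<^sup>2"
  using Q_pos[of t x] by (simp add: \<sigma>1_def \<sigma>_def divide_simps power2_eq_square)

lemma Q_has_derivative:
  assumes "t > 0"
  shows "(Q t has_derivative (\<lambda>h. Q t x * (x \<bullet> h) / (2 * \<mu> * t))) (at x)"
  unfolding Q_def power2_norm_eq_inner using assms \<mu>
  by (auto intro!: derivative_eq_intros simp: fun_eq_iff inner_commute field_simps)

lemma \<sigma>_has_derivative: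
  assumes "t > 0"
  shows "(\<sigma> t has_derivative (\<lambda>h. - (\<sigma>1 t x / (2 * \<mu> * t)) * (x \<bullet> h))) (at x)"
  unfolding \<sigma>_def \<sigma>1_eq[OF assms] using Q_pos[OF assms, of x] assms
  by (auto intro!: derivative_eq_intros Q_has_derivative simp: fun_eq_iff power2_eq_square)

lemma \<sigma>1_has_derivative:
  assumes "t > 0"
  shows "(\<sigma>1 t has_derivative (\<lambda>h. - (\<sigma>2 t x / (2 * \<mu> * t)) * (x \<bullet> h))) (at x)"
  unfolding \<sigma>1_def
  by (auto intro!: derivative_eq_intros \<sigma>_has_derivative assms simp: fun_eq_iff \<sigma>2_def \<sigma>1_def)
     (use assms \<mu> in \<open>simp add: field_simps\<close>)

lemma Q_has_time_derivative:
  fixes x :: "real^'n::finite"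
  assumes "t > 0"
  shows "((\<lambda>s. Q s x) has_real_derivative
    Q t x * (real CARD('n) / (2 * t) - (norm x)\<^sup>2 / (4 * \<mu> * t\<^sup>2))) (at t)"
proof -
  have "((\<lambda>s. (4 * pi * \<mu> * s) powr e) has_real_derivative (4 * pi * \<mu> * t) powr e * (e / t)) (at t)" for e
    using assms \<mu> by (auto intro!: derivative_eq_intros simp: powr_diff)
  moreover have "((\<lambda>s. exp ((norm x)\<^sup>2 / (4 * \<mu> * s))) has_real_derivative
      exp ((norm x)\<^sup>2 / (4 * \<mu> * t)) * (- (norm x)\<^sup>2 / (4 * \<mu> * t\<^sup>2))) (at t)"
    using assms \<mu> by (auto intro!: derivative_eq_intros simp: power2_eq_square)
  ultimately show ?thesis
    unfolding Q_def mult.assoc[of a]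
    by (intro DERIV_cong[OF DERIV_cmult[OF DERIV_mult]]) (auto simp: algebra_simps)
qed

lemma \<sigma>_has_time_derivative:
  fixes x :: "real^'n::finite"
  assumes "t > 0"
  shows "((\<lambda>s. \<sigma> s x) has_real_derivative
    - (\<sigma>1 t x) * (real CARD('n) / (2 * t) - (norm x)\<^sup>2 / (4 * \<mu> * t\<^sup>2))) (at t)"
  unfolding \<sigma>_def \<sigma>1_eq[OF assms] using Q_pos[OF assms, of x]
  by (auto intro!: derivative_eq_intros Q_has_time_derivative assms simp: power2_eq_square)

lemma ubar_has_time_derivative:
  fixes x :: "real^'n::finite"
  assumes "t > 0"
  shows "((\<lambda>s. ubar \<mu> a s x) has_vector_derivative ubar_time_deriv t x) (at t)"
  unfolding ubar_eq
proof -
  have "((\<lambda>s. \<sigma> s x / s) has_real_derivative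
      - (\<sigma> t x / t\<^sup>2 + \<sigma>1 t x / t * (real CARD('n) / (2 * t) - (norm x)\<^sup>2 / (4 * \<mu> * t\<^sup>2)))) (at t)"
    using assms by (auto intro!: derivative_eq_intros \<sigma>_has_time_derivative)
      (simp add: divide_simps power2_eq_square)
  from has_vector_derivative_scaleR[OF this has_vector_derivative_const[of x]]
  show "((\<lambda>s. (\<sigma> s x / s) *\<^sub>R x) has_vector_derivative ubar_time_deriv t x) (at t)"
    by (simp add: ubar_time_deriv_def)
qed

lemma ubar_has_derivative:
  assumes "t > 0"
  shows "(ubar \<mu> a t has_derivative
    (\<lambda>h. (\<sigma> t x / t) *\<^sub>R h - (\<sigma>1 t x * (x \<bullet> h) / (2 * \<mu> * t\<^sup>2)) *\<^sub>R x)) (at x)"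
  unfolding ubar_eq
  using assms by (auto intro!: derivative_eq_intros \<sigma>_has_derivative simp: fun_eq_iff power2_eq_square)

lemma ubar_has_partial_deriv:
  assumes "t > 0"
  shows "has_partial_deriv j (ubar \<mu> a t) (ubar_deriv1 j t)"
  using has_derivative_imp_has_partial_deriv[OF ubar_has_derivative[OF assms], where j=j]
  by (simp add: ubar_deriv1_def[abs_def] inner_axis)

lemma ubar_deriv1_has_partial_deriv:
  assumes "t > 0"
  shows "has_partial_deriv k (ubar_deriv1 j t) (ubar_deriv2 k j t)"
proof -
  have "(ubar_deriv1 j t has_derivative (\<lambda>h. - (\<sigma>1 t x * (x \<bullet> h) / (2 * \<mu> * t\<^sup>2)) *\<^sub>R axis j 1
     - ((\<sigma>1 t x * h $ j / (2 * \<mu> * t\<^sup>2)) *\<^sub>R x + 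
       (\<sigma>1 t x * (x $ j) / (2 * \<mu> * t\<^sup>2)) *\<^sub>R h
       - (\<sigma>2 t x * (x $ j) * (x \<bullet> h) / (4 * \<mu>\<^sup>2 * t ^ 3)) *\<^sub>R x))) (at x)" for x
  proof -
    have xj: "((\<lambda>x. x $ j) has_derivative (\<lambda>h. h $ j)) (at x)"
      by (intro bounded_linear_imp_has_derivative bounded_linear_vec_nth)
    have "((\<lambda>x. \<sigma> t x / t) has_derivative (\<lambda>h. - (\<sigma>1 t x * (x \<bullet> h) / (2 * \<mu> * t\<^sup>2)))) (at x)"
      using assms by (auto intro!: derivative_eq_intros \<sigma>_has_derivative simp: fun_eq_iff power2_eq_square)
    then have 1: "((\<lambda>x. (\<sigma> t x / t) *\<^sub>R axis j (1::real)) has_derivative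
        (\<lambda>h. - (\<sigma>1 t x * (x \<bullet> h) / (2 * \<mu> * t\<^sup>2)) *\<^sub>R axis j 1)) (at x)"
      by (rule has_derivative_scaleR_left)
    have "((\<lambda>x. \<sigma>1 t x * (x $ j) / (2 * \<mu> * t\<^sup>2)) has_derivative
        (\<lambda>h. (\<sigma>1 t x * h $ j + - (\<sigma>2 t x / (2 * \<mu> * t)) * (x \<bullet> h) * (x $ j)) / (2 * \<mu> * t\<^sup>2))) (at x)"
      by (intro bounded_linear.has_derivative[OF bounded_linear_divide] has_derivative_mult \<sigma>1_has_derivative assms xj)
    also have "(\<lambda>h. (\<sigma>1 t x * h $ j + - (\<sigma>2 t x / (2 * \<mu> * t)) * (x \<bullet> h) * (x $ j)) / (2 * \<mu> * t\<^sup>2))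
       = (\<lambda>h. \<sigma>1 t x * h $ j / (2 * \<mu> * t\<^sup>2) - \<sigma>2 t x * (x $ j) * (x \<bullet> h) / (4 * \<mu>\<^sup>2 * t ^ 3))"
      by (simp add: fun_eq_iff add_divide_distrib diff_divide_distrib power2_eq_square power3_eq_cube ac_simps)
    finally have "((\<lambda>x. (\<sigma>1 t x * (x $ j) / (2 * \<mu> * t\<^sup>2)) *\<^sub>R x) has_derivative
       (\<lambda>h. (\<sigma>1 t x * (x $ j) / (2 * \<mu> * t\<^sup>2)) *\<^sub>R h + 
          (\<sigma>1 t x * h $ j / (2 * \<mu> * t\<^sup>2) - \<sigma>2 t x * (x $ j) * (x \<bullet> h) / (4 * \<mu>\<^sup>2 * t ^ 3)) *\<^sub>R x)) (at x)"
      by (rule has_derivative_scaleR) (rule has_derivative_ident)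
    from has_derivative_diff[OF 1 this] show ?thesis
      unfolding ubar_deriv1_def by (simp add: algebra_simps)
  qed
  from has_derivative_imp_has_partial_deriv[OF this, where j=k]
  have "has_partial_deriv k (ubar_deriv1 j t) (\<lambda>x. - (\<sigma>1 t x * (x \<bullet> axis k 1) / (2 * \<mu> * t\<^sup>2)) *\<^sub>R axis j 1
     - ((\<sigma>1 t x * axis k 1 $ j / (2 * \<mu> * t\<^sup>2)) *\<^sub>R x + 
       (\<sigma>1 t x * (x $ j) / (2 * \<mu> * t\<^sup>2)) *\<^sub>R axis k 1
       - (\<sigma>2 t x * (x $ j) * (x \<bullet> axis k 1) / (4 * \<mu>\<^sup>2 * t ^ 3)) *\<^sub>R x))" .
  also have "(\<lambda>x. - (\<sigma>1 t x * (x \<bullet> axis k 1) / (2 * \<mu> * t\<^sup>2)) *\<^sub>R axis j 1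
     - ((\<sigma>1 t x * axis k 1 $ j / (2 * \<mu> * t\<^sup>2)) *\<^sub>R x + 
       (\<sigma>1 t x * (x $ j) / (2 * \<mu> * t\<^sup>2)) *\<^sub>R axis k 1
       - (\<sigma>2 t x * (x $ j) * (x \<bullet> axis k 1) / (4 * \<mu>\<^sup>2 * t ^ 3)) *\<^sub>R x)) = ubar_deriv2 k j t"
  proof -
    have "axis k (1::real) $ j = (if j = k then 1 else 0)" by (simp add: axis_def)
    then show ?thesis by (auto simp: fun_eq_iff ubar_deriv2_def inner_axis algebra_simps)
  qed
  finally show ?thesis .
qed

lemma ubar_deriv2_commute: "ubar_deriv2 j k t = ubar_deriv2 k j t"
  by (auto simp: ubar_deriv2_def fun_eq_iff algebra_simps)

lemma jacobian_ubar:
  assumes "t > 0"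
  shows "jacobian (ubar \<mu> a t) (at x) = (\<chi> i j. ubar_deriv1 j t x $ i)"
proof -
  have "frechet_derivative (ubar \<mu> a t) (at x)
      = (\<lambda>h. (\<sigma> t x / t) *\<^sub>R h - (\<sigma>1 t x * (x \<bullet> h) / (2 * \<mu> * t\<^sup>2)) *\<^sub>R x)"
    using frechet_derivative_at[OF ubar_has_derivative[OF assms, of x]] by simp
  then show ?thesis
    by (simp add: jacobian_def matrix_def ubar_deriv1_def inner_axis)
qed

lemma convection_ubar:
  assumes "t > 0"
  shows "convection (ubar \<mu> a t) x =
    ((\<sigma> t x)\<^sup>2 / t\<^sup>2 - \<sigma> t x * \<sigma>1 t x * (norm x)\<^sup>2 / (2 * \<mu> * t ^ 3)) *\<^sub>R x"
proof -
  let ?D = "\<lambda>h. (\<sigma> t x / t) *\<^sub>R h - (\<sigma>1 t x * (x \<bullet> h) / (2 * \<mu> * t\<^sup>2)) *\<^sub>R x"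
  have d: "(ubar \<mu> a t has_derivative ?D) (at x)"
    by (rule ubar_has_derivative[OF assms])
  then have "(ubar \<mu> a t has_derivative (\<lambda>h. jacobian (ubar \<mu> a t) (at x) *v h)) (at x)"
    using jacobian_works differentiableI by blast
  with d have "(\<lambda>h. jacobian (ubar \<mu> a t) (at x) *v h) = ?D"
    by (rule has_derivative_unique[rotated])
  then have "convection (ubar \<mu> a t) x = ?D (ubar \<mu> a t x)"
    unfolding convection_def by metis
  then show ?thesis
    unfolding power2_norm_eq_inner
    by (simp add: ubar_eq algebra_simps power2_eq_square power3_eq_cube)
qed

lemma has_partial_deriv_component:
  assumes "has_partial_deriv j f g"
  shows "has_partial_deriv j (\<lambda>y. f y $ i) (\<lambda>y. g y $ i)"
  using assms bounded_linear.has_vector_derivative[OF bounded_linear_vec_nth[of i]]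
  unfolding has_partial_deriv_def by blast

lemma vec_laplacian_ubar:
  assumes "t > 0"
  shows "vec_laplacian (ubar \<mu> a t) x = (\<Sum>j\<in>UNIV. ubar_deriv2 j j t x)"
proof -
  have "partial j (\<lambda>y. ubar \<mu> a t y $ i) = (\<lambda>y. ubar_deriv1 j t y $ i)" for i j :: 'a
    by (rule has_partial_derivD has_partial_deriv_component ubar_has_partial_deriv assms)+
  moreover have "partial j (\<lambda>y. ubar_deriv1 j t y $ i) = (\<lambda>y. ubar_deriv2 j j t y $ i)" for i j :: 'a
    by (rule has_partial_derivD has_partial_deriv_component ubar_deriv1_has_partial_deriv assms)+
  ultimately show ?thesis
    by (simp add: vec_laplacian_def laplacian_def vec_eq_iff)
qed

lemma sum_ubar_deriv2:
  fixes x :: "real^'n::finite"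
  shows "(\<Sum>j\<in>UNIV. ubar_deriv2 j j t x) =
    (\<sigma>2 t x * (norm x)\<^sup>2 / (4 * \<mu>\<^sup>2 * t ^ 3) - \<sigma>1 t x * (real CARD('n) + 2) / (2 * \<mu> * t\<^sup>2)) *\<^sub>R x"
proof -
  have nx: "(\<Sum>j\<in>UNIV. x $ j * x $ j) = (norm x)\<^sup>2"
    by (simp add: power2_norm_eq_inner inner_vec_def)
  have ax: "(\<Sum>j\<in>UNIV. (x $ j) *\<^sub>R axis j (1::real)) = x"
    using basis_expansion[of x] by (simp add: scalar_mult_eq_scaleR)
  have "(\<Sum>j\<in>UNIV. ubar_deriv2 j j t x) =
      (\<Sum>j\<in>UNIV. (\<sigma>2 t x / (4 * \<mu>\<^sup>2 * t ^ 3) * (x $ j * x $ j)) *\<^sub>R x)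
      - (\<Sum>j\<in>UNIV. (\<sigma>1 t x / (2 * \<mu> * t\<^sup>2)) *\<^sub>R ((x $ j) *\<^sub>R axis j 1 + (x $ j) *\<^sub>R axis j 1 + x))"
    by (simp add: ubar_deriv2_def sum_subtractf mult.assoc)
  also have "\<dots> = (\<sigma>2 t x / (4 * \<mu>\<^sup>2 * t ^ 3) * (norm x)\<^sup>2) *\<^sub>R x
      - (\<sigma>1 t x / (2 * \<mu> * t\<^sup>2)) *\<^sub>R (x + x + real CARD('n) *\<^sub>R x)"
    by (simp only: scaleR_sum_left[symmetric] sum_distrib_left[symmetric] nx scaleR_sum_right[symmetric]
        sum.distrib ax sum_constant_scaleR)
  also have "(\<sigma>1 t x / (2 * \<mu> * t\<^sup>2)) *\<^sub>R (x + x + real CARD('n) *\<^sub>R x)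
      = (\<sigma>1 t x * (real CARD('n) + 2) / (2 * \<mu> * t\<^sup>2)) *\<^sub>R x"
    by (simp add: vec_eq_iff add_divide_distrib distrib_left distrib_right)
  finally show ?thesis by (simp add: scaleR_diff_left)
qed

text \<open>
  Every term is a multiple of \<open>x\<close>, so only coefficients have to be compared. The convection term contributes the
  \<open>\<sigma>^2\<close> that turns \<open>- \<sigma>\<close>, from differentiating \<open>1/t\<close>, into \<open>- \<sigma> (1 - \<sigma>)\<close>, the factor common to all other terms.
\<close>

lemma ubar_equation:
  fixes x :: "real^'n::finite"
  assumes "t > 0"
  shows "ubar_time_deriv t x + convection (ubar \<mu> a t) x = \<mu> *\<^sub>R vec_laplacian (ubar \<mu> a t) x"
proof -
  define s n r \<rho> \<tau> where "s = \<sigma> t x" and "n = real CARD('n)" and "r = (norm x)\<^sup>2"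
    and "\<rho> = r / (4 * \<mu> * t ^ 3)" and "\<tau> = 1 / t\<^sup>2"
  have "- (s / t\<^sup>2 + s * (1 - s) / t * (n / (2 * t) - r / (4 * \<mu> * t\<^sup>2)))
      + (s\<^sup>2 / t\<^sup>2 - s * (s * (1 - s)) * r / (2 * \<mu> * t ^ 3))
    = - (s * \<tau> + s * (1 - s) * (n * \<tau> / 2 - \<rho>)) + (s\<^sup>2 * \<tau> - 2 * (s * (s * (1 - s))) * \<rho>)"
  proof -
    have "(n / (2 * t) - r / (4 * \<mu> * t\<^sup>2)) / t = n * \<tau> / 2 - \<rho>"
      by (simp add: \<tau>_def \<rho>_def power2_eq_square power3_eq_cube diff_divide_distrib)
    then have "s * (1 - s) / t * (n / (2 * t) - r / (4 * \<mu> * t\<^sup>2)) = s * (1 - s) * (n * \<tau> / 2 - \<rho>)"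
      by (metis times_divide_eq_left times_divide_eq_right)
    moreover have "w * r / (2 * \<mu> * t ^ 3) = 2 * w * \<rho>" for w
      by (simp add: \<rho>_def ac_simps)
    then have "s * (s * (1 - s)) * r / (2 * \<mu> * t ^ 3) = 2 * (s * (s * (1 - s))) * \<rho>" .
    ultimately show ?thesis by (simp add: \<tau>_def)
  qed
  also have "\<dots> = s * (1 - s) * (1 - 2 * s) * \<rho> - s * (1 - s) * (n + 2) * \<tau> / 2"
    by (simp add: power2_eq_square algebra_simps add_divide_distrib diff_divide_distrib)
  also have "\<dots> = \<mu> * (s * (1 - s) * (1 - 2 * s) * r / (4 * \<mu>\<^sup>2 * t ^ 3) - s * (1 - s) * (n + 2) / (2 * \<mu> * t\<^sup>2))"
    using \<mu> by (simp add: \<tau>_def \<rho>_def power2_eq_square[of \<mu>] right_diff_distrib[of \<mu>])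
  finally have "(- (s / t\<^sup>2 + s * (1 - s) / t * (n / (2 * t) - r / (4 * \<mu> * t\<^sup>2)))) *\<^sub>R x
      + (s\<^sup>2 / t\<^sup>2 - s * (s * (1 - s)) * r / (2 * \<mu> * t ^ 3)) *\<^sub>R x
    = \<mu> *\<^sub>R (s * (1 - s) * (1 - 2 * s) * r / (4 * \<mu>\<^sup>2 * t ^ 3) - s * (1 - s) * (n + 2) / (2 * \<mu> * t\<^sup>2)) *\<^sub>R x"
    by (simp only: scaleR_add_left[symmetric] scaleR_scaleR)
  then show ?thesis
    unfolding convection_ubar[OF assms] vec_laplacian_ubar[OF assms] sum_ubar_deriv2 ubar_time_deriv_def \<sigma>2_def \<sigma>1_def
      s_def n_def r_def .
qed

lemma continuous_on_Q: "continuous_on ({0<..} \<times> UNIV) (\<lambda>z. Q (fst z) (snd z))"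
  unfolding Q_def using \<mu> by (auto intro!: continuous_intros)

lemma continuous_on_\<sigma>:
  "continuous_on ({0<..} \<times> UNIV) (\<lambda>z::real \<times> (real^'n::finite). \<sigma> (fst z) (snd z))"
proof -
  have "1 + Q t x \<noteq> 0" if "t > 0" for t and x :: "real^'n" using Q_pos[OF that, of x] by simp
  then show ?thesis
    unfolding \<sigma>_def by (auto intro!: continuous_intros continuous_on_Q)
qed

lemma continuous_on_\<sigma>1: "continuous_on ({0<..} \<times> UNIV) (\<lambda>z. \<sigma>1 (fst z) (snd z))"
  unfolding \<sigma>1_def by (intro continuous_intros continuous_on_\<sigma>)

lemma continuous_on_\<sigma>2: "continuous_on ({0<..} \<times> UNIV) (\<lambda>z. \<sigma>2 (fst z) (snd z))"
  unfolding \<sigma>2_def by (intro continuous_intros continuous_on_\<sigma> continuous_on_\<sigma>1)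

lemmas continuous_on_logistic = continuous_on_\<sigma> continuous_on_\<sigma>1 continuous_on_\<sigma>2

lemma continuous_on_ubar_deriv1: "continuous_on ({0<..} \<times> UNIV) (\<lambda>z. ubar_deriv1 j (fst z) (snd z))"
  unfolding ubar_deriv1_def using \<mu> by (auto intro!: continuous_intros continuous_on_logistic)

lemma continuous_on_ubar_deriv2: "continuous_on ({0<..} \<times> UNIV) (\<lambda>z. ubar_deriv2 j k (fst z) (snd z))"
  unfolding ubar_deriv2_def using \<mu> by (cases "j = k") (auto intro!: continuous_intros continuous_on_logistic)

lemma continuous_on_ubar_time_deriv: "continuous_on ({0<..} \<times> UNIV) (\<lambda>z. ubar_time_deriv (fst z) (snd z))"
  unfolding ubar_time_deriv_def using \<mu> by (auto intro!: continuous_intros continuous_on_logistic)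

lemma classical_solution_ubar:
  "classical_solution \<mu> (ubar \<mu> a :: real \<Rightarrow> real^'n::finite \<Rightarrow> real^'n)"
  unfolding classical_solution_def
proof (intro conjI allI impI)
  let ?u = "ubar \<mu> a :: real \<Rightarrow> real^'n::finite \<Rightarrow> real^'n"
  show "(\<lambda>s. ?u s x) differentiable (at t)" if "t > 0" for t x
    using ubar_has_time_derivative[OF that] by (rule differentiableI_vector)
  show "?u t differentiable (at x)" if "t > 0" for t x
    using ubar_has_derivative[OF that] by (rule differentiableI)
  show "has_partial j (partial j (\<lambda>y. ?u t y $ i)) x" if "t > 0" for t x i j
    unfolding has_partial_derivD[OF has_partial_deriv_component[OF ubar_has_partial_deriv[OF that]]]
    by (rule has_partial_deriv_imp_has_partial[OF has_partial_deriv_component[OF ubar_deriv1_has_partial_deriv[OF that]]])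
  have vd: "vector_derivative (\<lambda>s. ?u s x) (at t) = ubar_time_deriv t x" if "t > 0" for t x
    using ubar_has_time_derivative[OF that] by (rule vector_derivative_at)
  show "vector_derivative (\<lambda>s. ?u s x) (at t) + convection (?u t) x = \<mu> *\<^sub>R vec_laplacian (?u t) x"
    if "t > 0" for t x
    using ubar_equation[OF that, of x] vd[OF that] by simp
  show "continuous_on ({0<..} \<times> UNIV) (\<lambda>(t, x). vector_derivative (\<lambda>s. ?u s x) (at t))"
    by (rule continuous_on_eq[OF continuous_on_ubar_time_deriv]) (auto simp: vd)
  have "continuous_on ({0<..} \<times> UNIV) (\<lambda>z::real \<times> (real^'n). \<chi> i j. ubar_deriv1 j (fst z) (snd z) $ i)"
    by (intro continuous_on_vec_lambda continuous_on_component continuous_on_ubar_deriv1)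
  then show "continuous_on ({0<..} \<times> UNIV) (\<lambda>(t, x). jacobian (?u t) (at x))"
    by (rule continuous_on_eq) (auto simp: jacobian_ubar)
  have "continuous_on ({0<..} \<times> UNIV) (\<lambda>z::real \<times> (real^'n). \<Sum>j\<in>UNIV. ubar_deriv2 j j (fst z) (snd z))"
    by (intro continuous_on_sum continuous_on_ubar_deriv2)
  then show "continuous_on ({0<..} \<times> UNIV) (\<lambda>(t, x). vec_laplacian (?u t) x)"
    by (rule continuous_on_eq) (auto simp: vec_laplacian_ubar)
qed

section \<open>Decay of the spatial derivatives\<close>

lemma \<sigma>_pos: "t > 0 \<Longrightarrow> \<sigma> t x > 0"
  using Q_pos[of t x] by (simp add: \<sigma>_def)

lemma \<sigma>_less_1: "t > 0 \<Longrightarrow> \<sigma> t x < 1"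
  using Q_pos[of t x] by (simp add: \<sigma>_def)

lemma abs_\<sigma>1_le: "t > 0 \<Longrightarrow> \<bar>\<sigma>1 t x\<bar> \<le> \<sigma> t x"
  using \<sigma>_pos[of t x] \<sigma>_less_1[of t x] by (simp add: \<sigma>1_def abs_mult mult_left_le)

lemma abs_\<sigma>2_le: "t > 0 \<Longrightarrow> \<bar>\<sigma>2 t x\<bar> \<le> \<sigma> t x"
  using \<sigma>_pos[of t x] \<sigma>_less_1[of t x] abs_\<sigma>1_le[of t x] mult_mono[of "\<bar>\<sigma>1 t x\<bar>" "\<sigma> t x" "\<bar>1 - 2 * \<sigma> t x\<bar>" 1]
  by (simp add: \<sigma>2_def abs_mult)

text \<open>
  Interpolates between \<open>\<sigma> \<le> 1\<close> and \<open>\<sigma> \<le> 1/Q\<close>. The exponent \<open>\<theta> = 1\<close> gives the best decay in \<open>x\<close> but loses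
  \<open>t^(-n/2)\<close>; a small \<open>\<theta>\<close> keeps some Gaussian decay and loses only a small power of \<open>t\<close>.
\<close>

lemma \<sigma>_le_powr:
  assumes "t > 0" "0 \<le> \<theta>" "\<theta> \<le> 1"
  shows "\<sigma> t x \<le> Q t x powr (- \<theta>)"
proof -
  let ?q = "Q t x"
  have q: "?q > 0" by (rule Q_pos[OF assms(1)])
  have "?q powr \<theta> \<le> 1 + ?q"
  proof (cases "?q \<le> 1")
    case True
    then have "?q powr \<theta> \<le> 1" using q assms by (intro powr_le1) auto
    then show ?thesis using q by simp
  next
    case False
    then have "?q powr \<theta> \<le> ?q powr 1" using assms by (intro powr_mono) auto
    then show ?thesis using q by simp
  qed
  then show ?thesis using q by (simp add: \<sigma>_def powr_minus divide_simps)
qed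

text \<open>
  Lists longer than two get a dummy value: only derivatives up to order two occur in the norms considered here.
\<close>

definition ubar_derivs :: "real \<Rightarrow> 'n list \<Rightarrow> real^'n::finite \<Rightarrow> real^'n" where
  "ubar_derivs t js =
    (case js of [] \<Rightarrow> ubar \<mu> a t | [j] \<Rightarrow> ubar_deriv1 j t | [j, k] \<Rightarrow> ubar_deriv2 j k t | _ \<Rightarrow> (\<lambda>x. 0))"

lemma ubar_derivs_has_partial_deriv:
  assumes "t > 0" "length js < 2"
  shows "has_partial_deriv j (ubar_derivs t js) (ubar_derivs t (j # js))"
  using assms ubar_has_partial_deriv[OF assms(1)] ubar_deriv1_has_partial_deriv[OF assms(1)]
  by (cases js rule: list_length_cases) (auto simp: ubar_derivs_def)

lemma continuous_on_ubar:
  "t > 0 \<Longrightarrow> continuous_on UNIV (ubar \<mu> a t :: real^'n::finite \<Rightarrow> real^'n)"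
  using ubar_has_derivative
  by (intro continuous_at_imp_continuous_on) (blast intro: has_derivative_continuous)

lemma continuous_on_ubar_derivs:
  fixes js :: "'n::finite list"
  assumes t: "t > 0" and "length js \<le> 2"
  shows "continuous_on UNIV (ubar_derivs t js)"
proof -
  have *: "continuous_on UNIV (\<lambda>x. f (fst (t, x)) (snd (t, x)))"
    if "continuous_on ({0<..} \<times> UNIV) (\<lambda>z. f (fst z) (snd z))" for f :: "real \<Rightarrow> real^'n \<Rightarrow> real^'n"
    using t by (intro continuous_on_compose2[OF that]) (auto intro!: continuous_intros)
  show ?thesis
    using assms continuous_on_ubar[OF t] *[OF continuous_on_ubar_deriv1] *[OF continuous_on_ubar_deriv2]
    by (cases js rule: list_length_cases) (auto simp: ubar_derivs_def)
qed

lemma ubar_derivs_perm: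
  assumes "mset js = mset ks"
  shows "ubar_derivs t js = ubar_derivs t ks"
proof -
  have len: "length js = length ks" using assms by (metis size_mset)
  show ?thesis
  proof (cases js rule: list_length_cases)
    case (3 j k)
    then obtain j' k' where ks: "ks = [j', k']"
      using len by (cases ks rule: list_length_cases) auto
    then have "js = ks \<or> (j' = k \<and> k' = j)"
      using 3 assms by (auto simp: add_eq_conv_ex)
    then show ?thesis using 3 ks ubar_deriv2_commute by (auto simp: ubar_derivs_def)
  next
    case 4
    then show ?thesis using len by (auto simp: ubar_derivs_def split: list.splits)
  qed (use assms in auto)
qed

text \<open>
  Parabolic scaling: with \<open>y = |x| / sqrt t\<close>, each spatial derivative costs a factor \<open>t^(-1/2)\<close>, and what remains is
  \<open>\<sigma>\<close> times a polynomial in \<open>y\<close> whose coefficients depend on \<open>\<mu>\<close> only.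
\<close>

lemma norm_ubar_derivs_le:
  fixes js :: "'n::finite list"
  assumes t: "t > 0"
  shows "norm (ubar_derivs t js x) \<le>
    (1 + 2 / \<mu> + 1 / \<mu>\<^sup>2) * t powr (- (1 + real (length js)) / 2) * ((1 + (norm x / sqrt t)\<^sup>2)\<^sup>2 * \<sigma> t x)"
proof -
  define s M y T where "s = \<sigma> t x" and "M = 1 + 2 / \<mu> + 1 / \<mu>\<^sup>2"
    and "y = norm x / sqrt t" and "T = sqrt t"
  have T: "T > 0" "t = T\<^sup>2"
    using t unfolding T_def by simp_all
  have x: "norm x = T * y" and y: "y \<ge> 0" using t by (auto simp: y_def T_def)
  have s: "s \<ge> 0" using \<sigma>_pos[OF t, of x] by (simp add: s_def)
  have M: "1 \<le> M" "1 + 1 / (2 * \<mu>) \<le> M" "1 / (4 * \<mu>\<^sup>2) + 3 / (2 * \<mu>) \<le> M"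
  proof -
    define r where "r = 1 / \<mu>"
    have r: "r > 0" using \<mu> by (simp add: r_def)
    have eq: "M = 1 + 2 * r + r\<^sup>2" "1 / (2 * \<mu>) = r / 2" "1 / (4 * \<mu>\<^sup>2) = r\<^sup>2 / 4" "3 / (2 * \<mu>) = 3 * r / 2"
      by (simp_all add: M_def r_def power_divide)
    show "1 \<le> M" "1 + 1 / (2 * \<mu>) \<le> M" "1 / (4 * \<mu>\<^sup>2) + 3 / (2 * \<mu>) \<le> M"
      unfolding eq using r zero_le_power2[of r] by linarith+
  qed
  have y1: "y \<le> (1 + y\<^sup>2)\<^sup>2" "1 \<le> (1 + y\<^sup>2)\<^sup>2" "y\<^sup>2 \<le> (1 + y\<^sup>2)\<^sup>2" "y ^ 3 \<le> (1 + y\<^sup>2)\<^sup>2"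
  proof -
    have 1: "1 \<le> 1 + y\<^sup>2" "y\<^sup>2 \<le> 1 + y\<^sup>2" by auto
    have 2: "y \<le> 1 + y\<^sup>2"
      using zero_le_power2[of "y - 1"] y unfolding power2_diff by simp
    have 3: "1 + y\<^sup>2 \<le> (1 + y\<^sup>2)\<^sup>2" by (rule self_le_power) auto
    have 4: "y * y\<^sup>2 \<le> (1 + y\<^sup>2) * (1 + y\<^sup>2)" using 1 2 y by (intro mult_mono) auto
    from 1 2 3 show "y \<le> (1 + y\<^sup>2)\<^sup>2" "1 \<le> (1 + y\<^sup>2)\<^sup>2" "y\<^sup>2 \<le> (1 + y\<^sup>2)\<^sup>2" by linarith+
    from 4 show "y ^ 3 \<le> (1 + y\<^sup>2)\<^sup>2" by (simp add: power3_eq_cube power2_eq_square mult.assoc)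
  qed
  have Tp: "t powr (- (1 + real k) / 2) = 1 / T ^ (Suc k)" for k
  proof -
    have "t powr (- (1 + real k) / 2) = (T powr 2) powr (- (1 + real k) / 2)" using T by simp
    also have "\<dots> = T powr (- real (Suc k))" by (simp add: powr_powr diff_divide_distrib)
    also have "\<dots> = 1 / T ^ (Suc k)"
      using T powr_realpow[of T "Suc k"] by (simp only: powr_minus_divide)
    finally show ?thesis .
  qed
  have comp: "\<bar>x $ i\<bar> \<le> T * y" for i using component_le_norm_cart[of x i] x by simp
  have "norm (ubar_derivs t js x) \<le> M * (1 / T ^ (Suc (length js))) * ((1 + y\<^sup>2)\<^sup>2 * s)"
  proof (cases js rule: list_length_cases)
    case 1
    have "norm (ubar_derivs t js x) = s / t * (T * y)"
      using 1 t s by (simp add: ubar_derivs_def ubar_eq x s_def)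
    also have "\<dots> = 1 / T * (y * s)"
      using T(1) by (simp add: T(2) power2_eq_square)
    also have "\<dots> \<le> (M * (1 / T)) * ((1 + y\<^sup>2)\<^sup>2 * s)"
      using T M s y1 y by (intro mult_mono) (auto simp: divide_simps)
    finally show ?thesis using 1 by simp
  next
    case (2 j)
    have "norm (ubar_derivs t js x) \<le> norm ((s / t) *\<^sub>R axis j (1::real)) + norm ((\<sigma>1 t x * (x $ j) / (2 * \<mu> * t\<^sup>2)) *\<^sub>R x)"
      unfolding 2 ubar_derivs_def list.case ubar_deriv1_def s_def by (rule norm_triangle_ineq4)
    also have "\<dots> = s / t + \<bar>\<sigma>1 t x\<bar> * \<bar>x $ j\<bar> * norm x / (2 * \<mu> * t\<^sup>2)"
      using s t \<mu> by (simp add: abs_mult)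
    also have "\<dots> \<le> s / t + s * (T * y) * (T * y) / (2 * \<mu> * t\<^sup>2)"
      using s t \<mu> T y abs_\<sigma>1_le[OF t, of x] comp[of j] x
      by (intro add_mono divide_right_mono mult_mono) (auto simp: s_def)
    also have "\<dots> = 1 / T\<^sup>2 * ((1 + y\<^sup>2 / (2 * \<mu>)) * s)"
    proof -
      have "s * (T * y) * (T * y) / (2 * \<mu> * (T\<^sup>2)\<^sup>2) = 1 / T\<^sup>2 * (y\<^sup>2 / (2 * \<mu>) * s)"
        using T(1) by (simp add: power2_eq_square ac_simps)
      then show ?thesis by (simp add: T(2) algebra_simps add_divide_distrib)
    qed
    also have "\<dots> \<le> 1 / T\<^sup>2 * ((M * (1 + y\<^sup>2)\<^sup>2) * s)"
    proof (intro mult_left_mono mult_right_mono)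
      have "1 + y\<^sup>2 / (2 * \<mu>) \<le> (1 + y\<^sup>2)\<^sup>2 + (1 + y\<^sup>2)\<^sup>2 / (2 * \<mu>)"
        using y1 \<mu> by (intro add_mono divide_right_mono) auto
      also have "\<dots> = (1 + 1 / (2 * \<mu>)) * (1 + y\<^sup>2)\<^sup>2" by (simp add: distrib_right)
      also have "\<dots> \<le> M * (1 + y\<^sup>2)\<^sup>2" using M by (intro mult_right_mono) auto
      finally show "1 + y\<^sup>2 / (2 * \<mu>) \<le> M * (1 + y\<^sup>2)\<^sup>2" .
    qed (use s in auto)
    finally show ?thesis using 2 by (simp add: mult_ac power2_eq_square)
  next
    case (3 j k)
    let ?A = "(\<sigma>2 t x * (x $ j) * (x $ k) / (4 * \<mu>\<^sup>2 * t ^ 3)) *\<^sub>R x"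
    let ?v = "(x $ j) *\<^sub>R axis k 1 + (x $ k) *\<^sub>R axis j 1 + (if j = k then x else 0)"
    have v: "norm ?v \<le> T * y + T * y + T * y"
      using comp[of j] comp[of k] x T y
      by (intro norm_triangle_le[OF add_mono] norm_triangle_le[of "_ *\<^sub>R _" "_ *\<^sub>R _", OF add_mono]) auto
    have "norm (ubar_derivs t js x) \<le> norm ?A + norm ((\<sigma>1 t x / (2 * \<mu> * t\<^sup>2)) *\<^sub>R ?v)"
      unfolding 3 ubar_derivs_def list.case ubar_deriv2_def by (rule norm_triangle_ineq4)
    also have "\<dots> = \<bar>\<sigma>2 t x\<bar> * \<bar>x $ j\<bar> * \<bar>x $ k\<bar> * norm x / (4 * \<mu>\<^sup>2 * t ^ 3) + \<bar>\<sigma>1 t x\<bar> * norm ?v / (2 * \<mu> * t\<^sup>2)"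
      using t \<mu> by (simp add: abs_mult)
    also have "\<dots> \<le> s * (T * y) * (T * y) * (T * y) / (4 * \<mu>\<^sup>2 * t ^ 3) + s * (T * y + T * y + T * y) / (2 * \<mu> * t\<^sup>2)"
      using s t \<mu> T y abs_\<sigma>1_le[OF t, of x] abs_\<sigma>2_le[OF t, of x] comp x v
      by (intro add_mono divide_right_mono mult_mono) (auto simp: s_def)
    also have "\<dots> = 1 / T ^ 3 * ((y ^ 3 / (4 * \<mu>\<^sup>2) + 3 * y / (2 * \<mu>)) * s)"
    proof -
      have "s * (T * y) * (T * y) * (T * y) / (4 * \<mu>\<^sup>2 * (T\<^sup>2) ^ 3) = 1 / T ^ 3 * (y ^ 3 / (4 * \<mu>\<^sup>2) * s)"
        using T(1) by (simp add: power2_eq_square power3_eq_cube ac_simps)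
      moreover have "s * (T * y + T * y + T * y) / (2 * \<mu> * (T\<^sup>2)\<^sup>2) = 1 / T ^ 3 * (3 * y / (2 * \<mu>) * s)"
        using T(1) by (simp add: power2_eq_square power3_eq_cube ac_simps)
      ultimately show ?thesis by (simp only: T(2) distrib_left distrib_right)
    qed
    also have "\<dots> \<le> 1 / T ^ 3 * ((M * (1 + y\<^sup>2)\<^sup>2) * s)"
    proof (intro mult_left_mono mult_right_mono)
      have "y ^ 3 / (4 * \<mu>\<^sup>2) + 3 * y / (2 * \<mu>) \<le> (1 + y\<^sup>2)\<^sup>2 / (4 * \<mu>\<^sup>2) + 3 * (1 + y\<^sup>2)\<^sup>2 / (2 * \<mu>)"
        using y1 \<mu> by (intro add_mono divide_right_mono) auto
      also have "\<dots> = (1 / (4 * \<mu>\<^sup>2) + 3 / (2 * \<mu>)) * (1 + y\<^sup>2)\<^sup>2" by (simp add: distrib_right)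
      also have "\<dots> \<le> M * (1 + y\<^sup>2)\<^sup>2" using M by (intro mult_right_mono) auto
      finally show "y ^ 3 / (4 * \<mu>\<^sup>2) + 3 * y / (2 * \<mu>) \<le> M * (1 + y\<^sup>2)\<^sup>2" .
    qed (use s T in auto)
    finally show ?thesis using 3 by (simp add: mult_ac power3_eq_cube)
  next
    case 4
    then have "ubar_derivs t js x = 0" by (auto simp: ubar_derivs_def split: list.splits)
    then show ?thesis using T M s by simp
  qed
  then show ?thesis unfolding Tp M_def y_def s_def by simp
qed

lemma ubar_derivs_gaussian_bound:
  assumes \<theta>: "0 < \<theta>" "\<theta> \<le> 1"
  shows "\<exists>C>0. \<forall>t>0. \<forall>js x. norm (ubar_derivs t js (x :: real^'n::finite)) \<le>
    C * t powr (- (1 + real (length js)) / 2 - \<theta> * real CARD('n) / 2) * exp (- (\<theta> / (8 * \<mu> * t)) * (norm x)\<^sup>2)"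
proof -
  define c M A where "c = \<theta> / (8 * \<mu>)" and "M = 1 + 2 / \<mu> + 1 / \<mu>\<^sup>2"
    and "A = (a * (4 * pi * \<mu>) powr (real CARD('n) / 2)) powr (- \<theta>)"
  have c: "c > 0" and M: "M > 0" and A: "A > 0"
    using \<mu> \<theta> a by (auto simp: c_def M_def A_def intro!: add_pos_pos)
  obtain K where K: "K > 0" "\<And>y. (1 + y\<^sup>2)\<^sup>2 * exp (- 2 * c * y\<^sup>2) \<le> K * exp (- c * y\<^sup>2)"
    using polynomial_times_gaussian_bounded[OF c] by blast
  show ?thesis
  proof (intro exI[of _ "M * K * A"] conjI allI impI)
    show "M * K * A > 0" using M K A by simp
    fix t :: real and js :: "'n list" and x :: "real^'n" assume t: "t > 0"
    define y \<beta> where "y = norm x / sqrt t" and "\<beta> = t powr (- (1 + real (length js)) / 2)"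
    have y2: "y\<^sup>2 = (norm x)\<^sup>2 / t" using t by (simp add: y_def power_divide)
    have "\<sigma> t x \<le> Q t x powr (- \<theta>)"
      using \<theta> by (intro \<sigma>_le_powr t) auto
    also have "Q t x = a * (4 * pi * \<mu>) powr (real CARD('n) / 2) * t powr (real CARD('n) / 2) * exp (y\<^sup>2 / (4 * \<mu>))"
      using t \<mu> by (simp add: Q_def powr_mult y2)
    also have "\<dots> powr (- \<theta>) = A * t powr (- \<theta> * real CARD('n) / 2) * exp (- 2 * c * y\<^sup>2)"
      using t \<mu> a by (simp add: A_def powr_mult powr_powr exp_powr_real c_def ac_simps)
    finally have "(1 + y\<^sup>2)\<^sup>2 * \<sigma> t x \<le> (1 + y\<^sup>2)\<^sup>2 * (A * t powr (- \<theta> * real CARD('n) / 2) * exp (- 2 * c * y\<^sup>2))"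
      by (intro mult_left_mono) auto
    also have "\<dots> = A * t powr (- \<theta> * real CARD('n) / 2) * ((1 + y\<^sup>2)\<^sup>2 * exp (- 2 * c * y\<^sup>2))"
      by (simp add: mult_ac)
    also have "\<dots> \<le> A * t powr (- \<theta> * real CARD('n) / 2) * (K * exp (- c * y\<^sup>2))"
      using A by (intro mult_left_mono K) auto
    finally have *: "(1 + y\<^sup>2)\<^sup>2 * \<sigma> t x \<le> A * t powr (- \<theta> * real CARD('n) / 2) * (K * exp (- c * y\<^sup>2))" .
    have "norm (ubar_derivs t js x) \<le> M * \<beta> * ((1 + y\<^sup>2)\<^sup>2 * \<sigma> t x)"
      unfolding M_def \<beta>_def y_def by (rule norm_ubar_derivs_le[OF t])
    also have "\<dots> \<le> M * \<beta> * (A * t powr (- \<theta> * real CARD('n) / 2) * (K * exp (- c * y\<^sup>2)))"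
      using M by (intro mult_left_mono *) (auto simp: \<beta>_def)
    also have "\<dots> = M * K * A * (\<beta> * t powr (- \<theta> * real CARD('n) / 2)) * exp (- c * y\<^sup>2)"
      by (simp add: mult_ac)
    also have "\<beta> * t powr (- \<theta> * real CARD('n) / 2) = t powr (- (1 + real (length js)) / 2 - \<theta> * real CARD('n) / 2)"
      unfolding \<beta>_def by (simp add: powr_add[symmetric])
    also have "- c * y\<^sup>2 = - (\<theta> / (8 * \<mu> * t)) * (norm x)\<^sup>2"
      by (simp add: c_def y2)
    finally show "norm (ubar_derivs t js x) \<le> M * K * A *
      t powr (- (1 + real (length js)) / 2 - \<theta> * real CARD('n) / 2) * exp (- (\<theta> / (8 * \<mu> * t)) * (norm x)\<^sup>2)" .
  qed
qed

text \<open>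
  The powers of \<open>t\<close> come from the bound on the derivative and from the integral of a Gaussian of width proportional to
  \<open>sqrt t\<close>, which is proportional to \<open>t^(n/2)\<close>.
\<close>

lemma ubar_derivs_Lp_bound:
  assumes \<theta>: "0 < \<theta>" "\<theta> \<le> 1" and p: "p > 0"
  shows "\<exists>C>0. \<forall>t>0. \<forall>js. (\<integral>\<^sup>+x. ennreal (norm (ubar_derivs t js (x :: real^'n::finite)) powr p) \<partial>lborel) \<le>
    ennreal (C * t powr ((real CARD('n) - p * (1 + real (length js)) - p * \<theta> * real CARD('n)) / 2))"
proof -
  obtain C where C: "C > 0" "\<And>t js x. t > 0 \<Longrightarrow> norm (ubar_derivs t js (x :: real^'n::finite)) \<le>
    C * t powr (- (1 + real (length js)) / 2 - \<theta> * real CARD('n) / 2) * exp (- (\<theta> / (8 * \<mu> * t)) * (norm x)\<^sup>2)"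
    using ubar_derivs_gaussian_bound[OF \<theta>, where 'n='n] by blast
  define L where "L = pi * 8 * \<mu> / (p * \<theta>)"
  have L: "L > 0" using \<mu> \<theta> p by (simp add: L_def)
  show ?thesis
  proof (intro exI[of _ "C powr p * L powr (real CARD('n) / 2)"] conjI allI impI)
    show "C powr p * L powr (real CARD('n) / 2) > 0" using C L by simp
    fix t :: real and js :: "'n list" assume t: "t > 0"
    define e where "e = - (1 + real (length js)) / 2 - \<theta> * real CARD('n) / 2"
    define c where "c = p * \<theta> / (8 * \<mu> * t)"
    have c: "c > 0" using \<mu> t \<theta> p by (simp add: c_def)
    have "(\<integral>\<^sup>+x. ennreal (norm (ubar_derivs t js (x :: real^'n)) powr p) \<partial>lborel) \<le>
      (\<integral>\<^sup>+x. ennreal ((C * t powr e) powr p) * ennreal (exp (- c * (norm (x :: real^'n))\<^sup>2)) \<partial>lborel)"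
    proof (rule nn_integral_mono)
      fix x :: "real^'n"
      have "norm (ubar_derivs t js x) powr p \<le> (C * t powr e * exp (- (\<theta> / (8 * \<mu> * t)) * (norm x)\<^sup>2)) powr p"
        using p C(2)[OF t, of js x] unfolding e_def by (intro powr_mono2) auto
      also have "\<dots> = (C * t powr e) powr p * exp (- c * (norm x)\<^sup>2)"
        using C t by (simp add: powr_mult exp_powr_real c_def)
      finally show "ennreal (norm (ubar_derivs t js x) powr p) \<le>
          ennreal ((C * t powr e) powr p) * ennreal (exp (- c * (norm x)\<^sup>2))"
        by (subst ennreal_mult[symmetric]) (auto intro: ennreal_leI)
    qed
    also have "\<dots> = ennreal ((C * t powr e) powr p) * ennreal (sqrt (pi / c) ^ DIM(real^'n))"
      by (subst nn_integral_cmult) (simp_all only: nn_integral_gaussian[OF c], measurable)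
    also have "\<dots> = ennreal ((C * t powr e) powr p * sqrt (pi / c) ^ CARD('n))"
      using c by (simp add: ennreal_mult)
    also have "sqrt (pi / c) ^ CARD('n) = (pi / c) powr (real CARD('n) / 2)"
      using c by (simp add: powr_half_sqrt[symmetric] powr_realpow[symmetric] powr_powr)
    also have "pi / c = L * t" using p \<theta> \<mu> t by (simp add: c_def L_def)
    also have "(C * t powr e) powr p * (L * t) powr (real CARD('n) / 2)
       = C powr p * L powr (real CARD('n) / 2) * (t powr (e * p) * t powr (real CARD('n) / 2))"
      using C t L by (simp add: powr_mult powr_powr)
    also have "t powr (e * p) * t powr (real CARD('n) / 2) =
        t powr ((real CARD('n) - p * (1 + real (length js)) - p * \<theta> * real CARD('n)) / 2)"
      by (subst powr_add[symmetric]) (rule arg_cong[where f="\<lambda>r. t powr r"], simp add: e_def field_simps)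
    finally show "(\<integral>\<^sup>+x. ennreal (norm (ubar_derivs t js x) powr p) \<partial>lborel) \<le> ennreal (C powr p * L powr (real CARD('n) / 2) *
        t powr ((real CARD('n) - p * (1 + real (length js)) - p * \<theta> * real CARD('n)) / 2))" .
  qed
qed

text \<open>
  The highest derivatives are the most singular ones as \<open>t\<close> tends to \<open>0\<close>; the factor \<open>(1 + t)^(pk)\<close> lets their power of
  \<open>t\<close> serve as a bound for the lower derivatives at all times.
\<close>

lemma sobolev_norm_ubar_bound:
  assumes p: "1 \<le> p" "p < real CARD('n) / (1 + real k)" and k: "k \<le> 2"
  shows "\<exists>C>0. \<exists>e>0. \<forall>t>0. sobolev_norm k p (ubar \<mu> a t :: real^'n::finite \<Rightarrow> real^'n)
    \<le> ennreal ((C * ((1 + t) powr (p * real k) * t powr e)) powr (1 / p))"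
proof -
  define n where "n = real CARD('n)"
  have n: "n > 0" by (simp add: n_def)
  define d where "d = n - p * (1 + real k)"
  have d: "d > 0" using p by (simp add: d_def n_def field_simps)
  \<comment> \<open>The loss p \<theta> n is at most half of the available exponent d.\<close>
  define \<theta> where "\<theta> = min 1 (d / (2 * p * n))"
  have \<theta>: "0 < \<theta>" "\<theta> \<le> 1" using d n p by (auto simp: \<theta>_def)
  define e where "e = (d - p * \<theta> * n) / 2"
  have "p * \<theta> * n \<le> d / 2"
  proof -
    have "\<theta> \<le> d / (2 * p * n)" by (simp add: \<theta>_def)
    then show ?thesis using p n by (simp add: field_simps)
  qed
  then have e: "e > 0" using d by (simp add: e_def)
  obtain C where C: "C > 0" "\<And>t js. t > 0 \<Longrightarrow> (\<integral>\<^sup>+x. ennreal (norm (ubar_derivs t js (x :: real^'n::finite)) powr p) \<partial>lborel) \<le>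
    ennreal (C * t powr ((n - p * (1 + real (length js)) - p * \<theta> * n) / 2))"
    using ubar_derivs_Lp_bound[OF \<theta>, of p, where 'n='n] p unfolding n_def by auto
  define N where "N = real (card {\<alpha>::'n \<Rightarrow> nat. (\<Sum>i\<in>UNIV. \<alpha> i) \<le> k})"
  have "N \<ge> 0" by (simp add: N_def)
  have "sobolev_norm k p (ubar \<mu> a t :: real^'n::finite \<Rightarrow> real^'n)
      \<le> ennreal (((N * C + 1) * ((1 + t) powr (p * real k) * t powr e)) powr (1 / p))" if t: "t > 0" for t
  proof -
    define B where "B = (1 + t) powr (p * real k) * t powr e"
    have B: "B \<ge> 0" by (simp add: B_def)
    have "sobolev_norm k p (ubar_derivs t [] :: real^'n \<Rightarrow> real^'n) \<le> ennreal ((N * (C * B)) powr (1 / p))"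
      unfolding N_def
    proof (rule sobolev_norm_le)
      fix js :: "'n list" assume js: "length js \<le> k"
      have "t powr ((n - p * (1 + real (length js)) - p * \<theta> * n) / 2)
         = t powr (p * (real k - real (length js)) / 2) * t powr e"
        by (subst powr_add[symmetric]) (rule arg_cong[where f="\<lambda>r. t powr r"], simp add: e_def d_def field_simps)
      also have "\<dots> \<le> (1 + t) powr (p * real k) * t powr e"
      proof (rule mult_right_mono)
        have "t powr (p * (real k - real (length js)) / 2) \<le> (1 + t) powr (p * (real k - real (length js)) / 2)"
          using t p js by (intro powr_mono2) auto
        also have "p * (real k - real (length js)) / 2 \<le> p * real k"
          using p js mult_left_mono[of "(real k - real (length js)) / 2" "real k" p] by simp
        then have "(1 + t) powr (p * (real k - real (length js)) / 2) \<le> (1 + t) powr (p * real k)"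
          using t by (intro powr_mono) auto
        finally show "t powr (p * (real k - real (length js)) / 2) \<le> (1 + t) powr (p * real k)" .
      qed simp
      finally have "C * t powr ((n - p * (1 + real (length js)) - p * \<theta> * n) / 2) \<le> C * B"
        using C unfolding B_def by (intro mult_left_mono) auto
      then show "(\<integral>\<^sup>+x. ennreal (norm (ubar_derivs t js (x :: real^'n::finite)) powr p) \<partial>lborel) \<le> ennreal (C * B)"
        using C(2)[OF t, of js] by (meson ennreal_leI order_trans)
    qed (use t k p C B in \<open>auto intro!: ubar_derivs_has_partial_deriv continuous_on_ubar_derivs ubar_derivs_perm\<close>)
    also have "ubar_derivs t [] = (ubar \<mu> a t :: real^'n \<Rightarrow> real^'n)" by (simp add: ubar_derivs_def)
    also have "ennreal ((N * (C * B)) powr (1 / p)) \<le> ennreal (((N * C + 1) * B) powr (1 / p))"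
      using B C \<open>N \<ge> 0\<close> p by (intro ennreal_leI powr_mono2) (auto simp: algebra_simps)
    finally show ?thesis by (simp add: B_def)
  qed
  \<comment> \<open>The summand 1 only serves to make the constant positive.\<close>
  moreover have "N * C + 1 > 0" using C \<open>N \<ge> 0\<close> by (auto intro: add_nonneg_pos)
  ultimately show ?thesis using e by blast
qed

lemma sobolev_norm_ubar:
  assumes p: "1 \<le> p" "p < real CARD('n) / (1 + real k)" and k: "k \<le> 2"
  shows "t > 0 \<Longrightarrow> sobolev_norm k p (ubar \<mu> a t :: real^'n::finite \<Rightarrow> real^'n) < \<infinity>"
    and "((\<lambda>t. sobolev_norm k p (ubar \<mu> a t :: real^'n::finite \<Rightarrow> real^'n)) \<longlongrightarrow> 0) (at_right 0)"
proof -
  obtain C e where Ce: "C > 0" "e > 0" and bound: "\<And>t. t > 0 \<Longrightarrow>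
     sobolev_norm k p (ubar \<mu> a t :: real^'n::finite \<Rightarrow> real^'n)
    \<le> ennreal ((C * ((1 + t) powr (p * real k) * t powr e)) powr (1 / p))"
    using sobolev_norm_ubar_bound[OF assms] by blast
  show "sobolev_norm k p (ubar \<mu> a t :: real^'n::finite \<Rightarrow> real^'n) < \<infinity>" if "t > 0"
    using bound[OF that] by (rule le_less_trans) simp
  have id0: "((\<lambda>t::real. t) \<longlongrightarrow> 0) (at_right 0)" by (rule tendsto_ident_at)
  have "((\<lambda>t. t powr e) \<longlongrightarrow> 0) (at_right 0)"
    by (rule tendsto_zero_powrI[OF id0 tendsto_const _ Ce(2)])
       (auto simp: eventually_at_filter)
  moreover have "((\<lambda>t. (1 + t) powr (p * real k)) \<longlongrightarrow> 1 powr (p * real k)) (at_right (0::real))"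
  proof (rule tendsto_powr[OF _ tendsto_const])
    show "((\<lambda>t. 1 + t) \<longlongrightarrow> 1) (at_right (0::real))"
      using tendsto_add[OF tendsto_const[of 1] id0] by simp
  qed simp
  ultimately have "((\<lambda>t. C * ((1 + t) powr (p * real k) * t powr e)) \<longlongrightarrow> C * (1 powr (p * real k) * 0)) (at_right 0)"
    by (intro tendsto_mult tendsto_const)
  then have "((\<lambda>t. (C * ((1 + t) powr (p * real k) * t powr e)) powr (1 / p)) \<longlongrightarrow> 0) (at_right 0)"
    using p Ce by (intro tendsto_zero_powrI[OF _ tendsto_const]) (auto intro!: always_eventually)
  then have lim: "((\<lambda>t. ennreal ((C * ((1 + t) powr (p * real k) * t powr e)) powr (1 / p))) \<longlongrightarrow> ennreal 0) (at_right 0)"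
    by (rule tendsto_ennrealI)
  show "((\<lambda>t. sobolev_norm k p (ubar \<mu> a t :: real^'n::finite \<Rightarrow> real^'n)) \<longlongrightarrow> 0) (at_right 0)"
  proof (rule tendsto_sandwich[OF _ _ tendsto_const])
    show "\<forall>\<^sub>F t in at_right 0. sobolev_norm k p (ubar \<mu> a t :: real^'n \<Rightarrow> real^'n)
        \<le> ennreal ((C * ((1 + t) powr (p * real k) * t powr e)) powr (1 / p))"
      using eventually_at_right_less[of "0::real"] by eventually_elim (rule bound)
  qed (use lim in simp_all)
qed

section \<open>The supremum norm\<close>

lemma Linf_norm_ubar_finite:
  assumes t: "t > 0"
  shows "Linf_norm (ubar \<mu> a t :: real^'n::finite \<Rightarrow> real^'n) < \<infinity>"
proof -
  obtain C where C: "C > 0" "\<And>t js x. t > 0 \<Longrightarrow> norm (ubar_derivs t js (x :: real^'n::finite)) \<le>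
    C * t powr (- (1 + real (length js)) / 2 - 1 * real CARD('n) / 2) * exp (- (1 / (8 * \<mu> * t)) * (norm x)\<^sup>2)"
    using ubar_derivs_gaussian_bound[of 1, where 'n='n] by auto
  define B where "B = C * t powr (- (1 + real 0) / 2 - 1 * real CARD('n) / 2)"
  have "norm (ubar \<mu> a t x) \<le> B" for x :: "real^'n"
  proof -
    have "norm (ubar \<mu> a t x) \<le> B * exp (- (1 / (8 * \<mu> * t)) * (norm x)\<^sup>2)"
      using C(2)[OF t, of "[]" x] by (simp add: ubar_derivs_def B_def)
    also have "\<dots> \<le> B * 1"
      using C(1) t \<mu> by (intro mult_left_mono) (auto simp: B_def)
    finally show ?thesis by simp
  qed
  then have "AE x in lebesgue. ennreal (norm (ubar \<mu> a t (x :: real^'n))) \<le> ennreal B"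
    by (intro always_eventually allI ennreal_leI)
  moreover have "(\<lambda>x. ennreal (norm (ubar \<mu> a t (x :: real^'n)))) \<in> borel_measurable lebesgue"
    using borel_measurable_continuous_onI[OF continuous_on_ubar[OF t, where 'n='n]]
    by (intro measurable_completion) measurable
  ultimately have "Linf_norm (ubar \<mu> a t :: real^'n \<Rightarrow> real^'n) \<le> ennreal B"
    unfolding Linf_norm_def by (rule esssup_I[rotated])
  then show ?thesis by (rule le_less_trans) simp
qed

text \<open>
  On the sphere \<open>|x| = sqrt t\<close> the exponential in \<open>Q\<close> is constant, so \<open>Q\<close> is bounded for \<open>t < 1\<close> and \<open>\<sigma>\<close> is bounded
  below; hence \<open>|ubar| = \<sigma> / sqrt t\<close> tends to infinity there.
\<close>

lemma Linf_norm_ubar_blowup: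
  "((\<lambda>t. Linf_norm (ubar \<mu> a t :: real^'n::finite \<Rightarrow> real^'n)) \<longlongrightarrow> \<infinity>) (at_right 0)"
proof -
  define q where "q = a * (4 * pi * \<mu>) powr (real CARD('n) / 2) * exp (1 / (4 * \<mu>))"
  have q: "q > 0" using a \<mu> by (simp add: q_def)
  have lower: "ennreal (1 / (1 + q) * inverse (sqrt t)) \<le> Linf_norm (ubar \<mu> a t :: real^'n \<Rightarrow> real^'n)"
    if t: "0 < t" "t < 1" for t
  proof -
    define x :: "real^'n" where "x = sqrt t *\<^sub>R axis undefined 1"
    have x: "norm x = sqrt t" using t by (simp add: x_def)
    have "Q t x = t powr (real CARD('n) / 2) * q"
      using t \<mu> by (simp add: Q_def q_def x powr_mult)
    also have "\<dots> \<le> 1 * q"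
      using t q by (intro mult_right_mono powr_le1) auto
    finally have "1 / (1 + q) \<le> \<sigma> t x"
      using Q_pos[OF t(1), of x] q by (simp add: \<sigma>_def frac_le)
    moreover have "sqrt t / t = inverse (sqrt t)"
      using t by (simp add: field_simps)
    moreover have "norm (ubar \<mu> a t x) = \<sigma> t x * (sqrt t / t)"
      using \<sigma>_pos[OF t(1), of x] t by (simp add: ubar_eq x)
    ultimately have "1 / (1 + q) * inverse (sqrt t) \<le> norm (ubar \<mu> a t x)"
      using t by (simp only:) (intro mult_right_mono; simp)
    then show ?thesis
      using Linf_norm_ge[OF continuous_on_ubar[OF t(1)], of x] by (meson ennreal_leI order_trans)
  qed
  have "((\<lambda>t. sqrt t) \<longlongrightarrow> sqrt 0) (at_right 0)"
    by (intro tendsto_real_sqrt tendsto_ident_at)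
  then have "filterlim (\<lambda>t. inverse (sqrt t)) at_top (at_right 0)"
    using eventually_at_right_less[of "0::real"]
    by (intro filterlim_inverse_at_top) (auto elim: eventually_mono)
  then have "filterlim (\<lambda>t. 1 / (1 + q) * inverse (sqrt t)) at_top (at_right 0)"
    using q by (intro filterlim_tendsto_pos_mult_at_top[OF tendsto_const]) auto
  then have lim: "((\<lambda>t. ennreal (1 / (1 + q) * inverse (sqrt t))) \<longlongrightarrow> \<infinity>) (at_right 0)"
    by (simp add: ennreal_tendsto_top_eq_at_top)
  show ?thesis
  proof (rule tendsto_sandwich[OF _ _ lim tendsto_const])
    have "\<forall>\<^sub>F t in at_right (0::real). t \<in> {0<..<1}"
      by (rule eventually_at_right_real) simp
    then show "\<forall>\<^sub>F t in at_right 0. ennreal (1 / (1 + q) * inverse (sqrt t))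
        \<le> Linf_norm (ubar \<mu> a t :: real^'n \<Rightarrow> real^'n)"
      by eventually_elim (use lower in auto)
  qed simp
qed

section \<open>The Cauchy problem\<close>

lemma ubar_nontrivial:
  assumes "t > 0"
  shows "ubar \<mu> a t (axis i 1) \<noteq> 0"
  using \<sigma>_pos[OF assms, of "axis i 1"] assms by (simp add: ubar_eq)

lemma cauchy_solution_ubar:
  assumes "1 \<le> p" "p < real CARD('n) / (1 + real k)" "k \<le> 2"
  shows "cauchy_solution k p \<mu> (\<lambda>x. 0) (ubar \<mu> a :: real \<Rightarrow> real^'n::finite \<Rightarrow> real^'n)"
  using classical_solution_ubar sobolev_norm_ubar(2)[OF assms] by (simp add: cauchy_solution_def)

end

lemma cauchy_solution_zero:
  assumes "p > 0"
  shows "cauchy_solution k p \<mu> (\<lambda>x. 0) (\<lambda>t x. 0 :: real^'n::finite)"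
proof -
  have [simp]: "partial j (\<lambda>y::real^'n. 0 :: real) = (\<lambda>y. 0)" for j
    by (simp add: partial_def fun_eq_iff)
  have [simp]: "jacobian (\<lambda>y. 0 :: real^'n) (at (x :: real^'n)) = 0" for x
    by (simp add: jacobian_def matrix_def frechet_derivative_const zero_vec_def)
  have [simp]: "vec_laplacian (\<lambda>y. 0 :: real^'n) (x :: real^'n) = 0" for x
    by (simp add: vec_laplacian_def laplacian_def zero_vec_def)
  have "classical_solution \<mu> (\<lambda>t x. 0 :: real^'n)"
    by (simp add: classical_solution_def has_partial_def convection_def)
  moreover have "sobolev_norm k p (\<lambda>x :: real^'n. 0 :: real^'n) = 0"
  proof -
    have "sobolev_norm k p (\<lambda>x :: real^'n. 0 :: real^'n) \<le>
      ennreal ((real (card {\<alpha>::'n \<Rightarrow> nat. (\<Sum>i\<in>UNIV. \<alpha> i) \<le> k}) * 0) powr (1 / p))"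
      by (rule sobolev_norm_le[where G="\<lambda>_ _. 0"]) (use assms in \<open>auto simp: has_partial_deriv_def\<close>)
    then show ?thesis by simp
  qed
  ultimately show ?thesis by (simp add: cauchy_solution_def)
qed

theorem mainTheorem2:
  fixes \<mu> a :: real and u :: "real \<Rightarrow> real^'n::finite \<Rightarrow> real^'n"
  assumes "\<mu> > 0" and "a > 0" and "CARD('n) \<ge> 2"
    and u_def: "u = ubar \<mu> a"
  shows "classical_solution \<mu> u
    \<and> (\<exists>t>0. \<exists>x. u t x \<noteq> 0)
    \<and> (\<forall>t>0. Linf_norm (u t) < \<infinity>)
    \<and> ((\<lambda>t. Linf_norm (u t)) \<longlongrightarrow> \<infinity>) (at_right 0)
    \<and> (\<forall>p. 1 \<le> p \<and> p < real CARD('n) / 2 \<longrightarrow>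
          (\<forall>t>0. sobolev_norm 1 p (u t) < \<infinity>) \<and>
          ((\<lambda>t. sobolev_norm 1 p (u t)) \<longlongrightarrow> 0) (at_right 0))
    \<and> (\<forall>p. 1 \<le> p \<and> p < real CARD('n) / 3 \<longrightarrow>
          (\<forall>t>0. sobolev_norm 2 p (u t) < \<infinity>) \<and>
          ((\<lambda>t. sobolev_norm 2 p (u t)) \<longlongrightarrow> 0) (at_right 0))
    \<and> (\<forall>p. 1 \<le> p \<and> p < real CARD('n) / 2 \<longrightarrow>
          cauchy_solution 1 p \<mu> (\<lambda>x. 0) (\<lambda>t x. 0 :: real^'n) \<and>
          cauchy_solution 1 p \<mu> (\<lambda>x. 0) u)
    \<and> (\<forall>p. 1 \<le> p \<and> p < real CARD('n) / 3 \<longrightarrow>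
          cauchy_solution 2 p \<mu> (\<lambda>x. 0) (\<lambda>t x. 0 :: real^'n) \<and>
          cauchy_solution 2 p \<mu> (\<lambda>x. 0) u)"
proof -
  interpret burgers_parameters \<mu> a
    using assms(1,2) by unfold_locales
  have u: "u t = ubar \<mu> a t" for t by (simp add: u_def)
  have 1: "sobolev_norm k p (u t) < \<infinity>"
    if "1 \<le> p" "p < real CARD('n) / (1 + real k)" "k \<le> 2" "t > 0" for k p t
    unfolding u using that by (rule sobolev_norm_ubar(1))
  have 2: "((\<lambda>t. sobolev_norm k p (u t)) \<longlongrightarrow> 0) (at_right 0)"
    if "1 \<le> p" "p < real CARD('n) / (1 + real k)" "k \<le> 2" for k p
    unfolding u using that by (rule sobolev_norm_ubar(2))
  have 3: "cauchy_solution k p \<mu> (\<lambda>x. 0) (\<lambda>t x. 0 :: real^'n) \<and> cauchy_solution k p \<mu> (\<lambda>x. 0) u"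
    if "1 \<le> p" "p < real CARD('n) / (1 + real k)" "k \<le> 2" for k p
    unfolding u_def using that by (auto intro!: cauchy_solution_zero cauchy_solution_ubar)
  have nontrivial: "\<exists>t>0. \<exists>x. u t x \<noteq> 0"
    unfolding u using ubar_nontrivial[of 1] by (intro exI[of _ "1::real"]) auto
  show ?thesis
  proof (intro conjI nontrivial)
    show "classical_solution \<mu> u" unfolding u_def by (rule classical_solution_ubar)
    show "\<forall>t>0. Linf_norm (u t) < \<infinity>" unfolding u using Linf_norm_ubar_finite by blast
    show "((\<lambda>t. Linf_norm (u t)) \<longlongrightarrow> \<infinity>) (at_right 0)" unfolding u by (rule Linf_norm_ubar_blowup)
  qed (use 1[of _ 1] 1[of _ 2] 2[of _ 1] 2[of _ 2] 3[of _ 1] 3[of _ 2] in simp_all)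
qed

end
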